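(* Let $\alpha\colon E\to B$ be a continuous group morphism between locally compact topological groups. Then the restriction functor $\alpha^*\colon Pt_B(\mathrm{TopGrp})\to Pt_E(\mathrm{TopGrp})$ has a right adjoint (a co-induction functor along $\alpha$). Explicitly, it is given by $$Y\longmapsto \alpha_!(Y)=t^\infty\bigl(B,\hom_E(B,Y)\bigr),$$ which is the largest topological group endowed with a monomorphism into $\hom_E(B,Y)$ on which $B$ acts continuously; that is, $B$ acts topologically on $t^\infty(B,\hom_E(B,Y))$, the inclusion $t^\infty(B,\hom_E(B,Y))\to\hom_E(B,Y)$ is a continuous injective $B$-equivariant morphism, and for every topological group $X$ with a topological $B$-action, any continuous injective $B$-equivariant group morphism $X\to\hom_E(B,Y)$ factors through a continuous morphism $X\to t^\infty(B,\hom_E(B,Y))$.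
   Context: $\mathrm{TopGrp}$ is the category of topological groups (not assumed Hausdorff) and continuous group morphisms. Locally compact does not include any Hausdorff condition. A topological action of $B$ on a topological group $G$ is an action by group automorphisms such that $B\times G\to G$ is continuous. $Pt_B(\mathrm{TopGrp})$ is the category of points over $B$ (split epimorphisms onto $B$ with given sections), identified with the category of topological groups with a topological $B$-action and continuous $B$-equivariant group morphisms. The functor $\alpha^*$ (pullback of points along $\alpha$) restricts a $B$-action to an $E$-action along $\alpha$. For $Y$ with a topological $E$-action, $\hom_E(B,Y)$ is the group (pointwise multiplication) of all maps of sets $u\colon B\to Y$ (not necessarily continuous) with $u(\alpha(e)b)=e\cdot u(b)$ for all $e\in E$, $b\in B$, with the topology induced by the product topology on $Y^B$. The group $B$ acts on it by continuous automorphisms via $(b\cdot u)(x)=u(xb)$. Construction of $t^\infty(B,G)$: let $G$ be a topological group on which the abstract group $B$ acts by continuous automorphisms. Let $G_1=\{g\in G\mid \text{the map } B\to G,\ b\mapsto b\cdot g\text{ is continuous}\}$, a $B$-stable subgroup, and let $\tau_1$ be the topology on $G_1$ induced by the injection $G_1\to\mathcal C(B,G)$, $g\mapsto(b\mapsto b\cdot g)$, where $\mathcal C(B,G)$ is the group of continuous maps with the compact-open topology. Put $t(G)=(G_1,\tau_1)$, on which $B$ again acts by continuous automorphisms. Then $t^\infty(B,G)$ is the projective limit in topological groups of the iterates $t^l(G)$: the intersection of the underlying groups, with the topology generated by the restrictions of the topologies of the $t^l(G)$. *)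

theory Defs
  imports "HOL-Analysis.Analysis" "HOL-Algebra.Bij" "HOL-Algebra.Product_Groups"
begin

section \<open>Topological groups and topological actions\<close>

record 'a topgroup = "'a monoid" +
  topo :: "'a topology"

text \<open>No separation axiom is imposed.\<close>

definition topological_group :: "('a, 'm) topgroup_scheme \<Rightarrow> bool" where
  "topological_group G \<longleftrightarrow>
     group G \<and> topspace (topo G) = carrier G \<and>
     continuous_map (prod_topology (topo G) (topo G)) (topo G) (\<lambda>(x, y). x \<otimes>\<^bsub>G\<^esub> y) \<and>
     continuous_map (topo G) (topo G) (\<lambda>x. inv\<^bsub>G\<^esub> x)"

text \<open>A topological group with elements in \<open>'a\<close>, together with an action of a group with elements
  in \<open>'b\<close>. In all uses the action is a homomorphism into \<open>AutoGroup X\<close>, so that each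
  \<open>act X b\<close> is extensional on \<open>carrier X\<close>.\<close>

record ('b, 'a) actgroup = "'a topgroup" +
  act :: "'b \<Rightarrow> 'a \<Rightarrow> 'a"

text \<open>The topology of \<open>B\<close> plays no role here.\<close>

definition acts_by_continuous_automorphisms ::
    "('b, 'm) topgroup_scheme \<Rightarrow> ('b, 'a) actgroup \<Rightarrow> bool" where
  "acts_by_continuous_automorphisms B X \<longleftrightarrow>
     act X \<in> hom B (AutoGroup X) \<and>
     (\<forall>b\<in>carrier B. continuous_map (topo X) (topo X) (act X b))"

text \<open>Objects of the category of points over \<open>B\<close>, in the form of topological groups with a
  topological \<open>B\<close>-action.\<close>

definition pt_object :: "('b, 'm) topgroup_scheme \<Rightarrow> ('b, 'a) actgroup \<Rightarrow> bool" where
  "pt_object B X \<longleftrightarrow>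
     topological_group X \<and>
     act X \<in> hom B (AutoGroup X) \<and>
     continuous_map (prod_topology (topo B) (topo X)) (topo X) (\<lambda>(b, x). act X b x)"

text \<open>Morphisms are extensional, so that equality of morphisms is equality of functions. The identity
  of \<open>X\<close> is \<open>\<lambda>x\<in>carrier X. x\<close> and composition is \<open>compose (carrier X)\<close>. The definition
  is also used when \<open>X\<close> or \<open>Y\<close> is not an object of the category of points, the action being
  merely one by continuous automorphisms.\<close>

definition pt_hom ::
    "('b, 'm) topgroup_scheme \<Rightarrow> ('b, 'x) actgroup \<Rightarrow> ('b, 'y) actgroup \<Rightarrow> ('x \<Rightarrow> 'y) set" where
  "pt_hom B X Y =
     {f \<in> hom X Y \<inter> extensional (carrier X).
        continuous_map (topo X) (topo Y) f \<and>
        (\<forall>b\<in>carrier B. \<forall>x\<in>carrier X. f (act X b x) = act Y b (f x))}"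

text \<open>The restriction functor along \<open>\<alpha>\<close> on objects; on morphisms it is the identity.\<close>

definition restrict_action :: "('e \<Rightarrow> 'b) \<Rightarrow> ('b, 'a) actgroup \<Rightarrow> ('e, 'a) actgroup" where
  "restrict_action \<alpha> X =
     \<lparr>carrier = carrier X, monoid.mult = monoid.mult X, one = one X, topo = topo X,
      act = (\<lambda>e. act X (\<alpha> e))\<rparr>"

section \<open>The group of \<open>E\<close>-equivariant maps\<close>

definition equivariant_maps ::
    "('e, 'm) topgroup_scheme \<Rightarrow> ('b, 'n) topgroup_scheme \<Rightarrow> ('e \<Rightarrow> 'b) \<Rightarrow> ('e, 'y) actgroup
      \<Rightarrow> ('b \<Rightarrow> 'y) set" where
  "equivariant_maps E B \<alpha> Y =
     {u \<in> carrier B \<rightarrow>\<^sub>E carrier Y.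
        \<forall>e\<in>carrier E. \<forall>b\<in>carrier B. u (\<alpha> e \<otimes>\<^bsub>B\<^esub> b) = act Y e (u b)}"

definition hom_group ::
    "('e, 'm) topgroup_scheme \<Rightarrow> ('b, 'n) topgroup_scheme \<Rightarrow> ('e \<Rightarrow> 'b) \<Rightarrow> ('e, 'y) actgroup
      \<Rightarrow> ('b, 'b \<Rightarrow> 'y) actgroup" where
  "hom_group E B \<alpha> Y =
     \<lparr>carrier = equivariant_maps E B \<alpha> Y,
      monoid.mult = monoid.mult (product_group (carrier B) (\<lambda>_. Y)),
      one = one (product_group (carrier B) (\<lambda>_. Y)),
      topo = subtopology (product_topology (\<lambda>_. topo Y) (carrier B)) (equivariant_maps E B \<alpha> Y),
      act = (\<lambda>b. \<lambda>u\<in>equivariant_maps E B \<alpha> Y. \<lambda>x\<in>carrier B. u (x \<otimes>\<^bsub>B\<^esub> b))\<rparr>"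

section \<open>The construction \<open>t\<^sup>\<infinity>\<close>\<close>

definition continuous_maps :: "'a topology \<Rightarrow> 'b topology \<Rightarrow> ('a \<Rightarrow> 'b) set" where
  "continuous_maps S T = {f \<in> extensional (topspace S). continuous_map S T f}"

text \<open>The compact sets are not required to be Hausdorff. Taking \<open>K = {}\<close> shows that the underlying
  set is all of \<open>continuous_maps S T\<close>.\<close>

definition compact_open_topology :: "'a topology \<Rightarrow> 'b topology \<Rightarrow> ('a \<Rightarrow> 'b) topology" where
  "compact_open_topology S T =
     topology_generated_by
       {{f \<in> continuous_maps S T. f ` K \<subseteq> U} | K U. compactin S K \<and> openin T U}"

definition continuous_elements ::
    "('b, 'm) topgroup_scheme \<Rightarrow> ('b, 'g) actgroup \<Rightarrow> 'g set" where
  "continuous_elements B G =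
     {g \<in> carrier G. continuous_map (topo B) (topo G) (\<lambda>b. act G b g)}"

definition t_step ::
    "('b, 'm) topgroup_scheme \<Rightarrow> ('b, 'g) actgroup \<Rightarrow> ('b, 'g) actgroup" where
  "t_step B G =
     \<lparr>carrier = continuous_elements B G, monoid.mult = monoid.mult G, one = one G,
      topo = pullback_topology (continuous_elements B G) (\<lambda>g. \<lambda>b\<in>carrier B. act G b g)
               (compact_open_topology (topo B) (topo G)),
      act = (\<lambda>b. restrict (act G b) (continuous_elements B G))\<rparr>"

definition t_iter ::
    "('b, 'm) topgroup_scheme \<Rightarrow> nat \<Rightarrow> ('b, 'g) actgroup \<Rightarrow> ('b, 'g) actgroup" where
  "t_iter B l = (t_step B ^^ l)"

definition t_infty ::
    "('b, 'm) topgroup_scheme \<Rightarrow> ('b, 'g) actgroup \<Rightarrow> ('b, 'g) actgroup" where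
  "t_infty B G =
     (let C = (\<Inter>l. carrier (t_iter B l G)) in
      \<lparr>carrier = C, monoid.mult = monoid.mult G, one = one G,
       topo = topology_generated_by (\<Union>l. {U \<inter> C | U. openin (topo (t_iter B l G)) U}),
       act = (\<lambda>b. restrict (act G b) C)\<rparr>)"

section \<open>Co-induction\<close>

definition coinduction ::
    "('e, 'm) topgroup_scheme \<Rightarrow> ('b, 'n) topgroup_scheme \<Rightarrow> ('e \<Rightarrow> 'b) \<Rightarrow> ('e, 'y) actgroup
      \<Rightarrow> ('b, 'b \<Rightarrow> 'y) actgroup" where
  "coinduction E B \<alpha> Y = t_infty B (hom_group E B \<alpha> Y)"

text \<open>Post-composition with \<open>f\<close>, for \<open>f\<close> a morphism with domain \<open>Y\<close>.\<close>

definition coinduction_map ::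
    "('e, 'm) topgroup_scheme \<Rightarrow> ('b, 'n) topgroup_scheme \<Rightarrow> ('e \<Rightarrow> 'b) \<Rightarrow> ('e, 'y) actgroup
      \<Rightarrow> ('y \<Rightarrow> 'z) \<Rightarrow> ('b \<Rightarrow> 'y) \<Rightarrow> ('b \<Rightarrow> 'z)" where
  "coinduction_map E B \<alpha> Y f =
     (\<lambda>u\<in>carrier (coinduction E B \<alpha> Y). compose (carrier B) f u)"

text \<open>The map sending an \<open>E\<close>-morphism from the restriction of \<open>X\<close> to the corresponding
  \<open>B\<close>-morphism out of \<open>X\<close>. Restriction and co-induction are families indexed by the types
  of elements of the groups, so the adjunction is expressed by the bijectivity and naturality of this
  polymorphic map.\<close>

definition coinduction_transpose ::
    "('b, 'n) topgroup_scheme \<Rightarrow> ('b, 'x) actgroup \<Rightarrow> ('x \<Rightarrow> 'y) \<Rightarrow> ('x \<Rightarrow> 'b \<Rightarrow> 'y)" where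
  "coinduction_transpose B X f = (\<lambda>x\<in>carrier X. \<lambda>b\<in>carrier B. f (act X b x))"

end

theory Submission
  imports Defs
begin

text \<open>
  The heart of the matter is a universal property of one refinement step. Let \<open>B\<close> be locally
  compact. A map \<open>f : A \<rightarrow> t(G)\<close> is continuous if and only if \<open>(b, a) \<mapsto> b \<cdot> f a\<close> is a
  continuous map \<open>B \<times> A \<rightarrow> G\<close> (\<open>continuous_map_t_step_iff\<close>). This is the exponential law
  for the compact-open topology (\<open>continuous_map_compact_open_topology_iff\<close>), which requires
  that the points of \<open>B\<close> have arbitrarily small compact neighbourhoods; they do, because a
  topological group is regular, Hausdorff or not.

  The properties of \<open>t\<^sup>\<infinity>\<close> are formal consequences. The group operations of \<open>t(G)\<close> are
  continuous, and the action becomes a continuous map \<open>B \<times> t(G) \<rightarrow> G\<close>. In the limit of the maps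
  \<open>B \<times> t\<^sup>l\<^sup>+\<^sup>1(G) \<rightarrow> t\<^sup>l(G)\<close> it becomes a continuous action on \<open>t\<^sup>\<infinity>(G)\<close>
  (\<open>pt_object_t_infty\<close>). Conversely, if \<open>B\<close> acts continuously on \<open>X\<close> and \<open>f : X \<rightarrow> G\<close> is a
  continuous equivariant morphism, then \<open>b \<cdot> f x = f (b \<cdot> x)\<close> is jointly continuous, so
  \<open>f\<close> is continuous into \<open>t(G)\<close>, and by induction into every \<open>t\<^sup>l(G)\<close>. Hence morphisms
  from \<open>X\<close> to \<open>t\<^sup>\<infinity>(G)\<close> and to \<open>G\<close> are the same (\<open>pt_hom_t_infty_eq\<close>). This contains the
  maximality of \<open>t\<^sup>\<infinity>(G)\<close>.

  It remains to compare \<open>E\<close>-morphisms \<open>X \<rightarrow> Y\<close> with \<open>B\<close>-morphisms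
  \<open>X \<rightarrow> hom\<^sub>E(B, Y)\<close>. These correspond to each other as for plain sets:
  \<open>f\<close> is sent to \<open>x \<mapsto> (b \<mapsto> f (b \<cdot> x))\<close>, with evaluation at \<open>1\<close> as the inverse
  (\<open>bij_betw_transpose_hom_group\<close>). Continuity is no obstacle, since \<open>hom\<^sub>E(B, Y)\<close> carries
  the topology of pointwise convergence. Naturality and functoriality are calculations with values.
\<close>

section \<open>Topological groups\<close>

lemma topological_groupD:
  assumes "topological_group G"
  shows "group G" "topspace (topo G) = carrier G"
  using assms by (simp_all add: topological_group_def)

lemma continuous_map_group_mult:
  assumes "topological_group G" "continuous_map A (topo G) f" "continuous_map A (topo G) g"
  shows "continuous_map A (topo G) (\<lambda>a. f a \<otimes>\<^bsub>G\<^esub> g a)"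
  using continuous_map_compose[OF continuous_map_pairedI[OF assms(2,3)]] assms(1)
  unfolding topological_group_def by (fastforce simp: o_def)

lemma continuous_map_group_inv:
  assumes "topological_group G" "continuous_map A (topo G) f"
  shows "continuous_map A (topo G) (\<lambda>a. inv\<^bsub>G\<^esub> f a)"
  using continuous_map_compose[OF assms(2)] assms(1)
  unfolding topological_group_def by (fastforce simp: o_def)

lemma continuous_map_action:
  assumes "pt_object B X" "continuous_map A (topo B) \<beta>" "continuous_map A (topo X) f"
  shows "continuous_map A (topo X) (\<lambda>a. act X (\<beta> a) (f a))"
  using continuous_map_compose[OF continuous_map_pairedI[OF assms(2,3)]] assms(1)
  unfolding pt_object_def by (fastforce simp: o_def)

text \<open>If \<open>a\<close> lies in the complement \<open>W\<close> of a closed set \<open>C\<close>, continuity of multiplication at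
  \<open>(a, 1)\<close> gives open \<open>P \<ni> a\<close> and \<open>N \<ni> 1\<close> with \<open>P N \<subseteq> W\<close>; then \<open>P\<close> is disjoint from
  the open set \<open>C N\<^sup>-\<^sup>1 \<supseteq> C\<close>.\<close>

lemma topological_group_imp_regular_space:
  assumes "topological_group G"
  shows "regular_space (topo G)"
  unfolding regular_space_def
proof (intro allI impI)
  fix C a assume Ca: "closedin (topo G) C \<and> a \<in> topspace (topo G) - C"
  interpret group G using assms by (simp add: topological_group_def)
  have ts: "topspace (topo G) = carrier G"
    using assms by (simp add: topological_group_def)
  define W where "W = carrier G - C"
  have W: "openin (topo G) W" and aW: "a \<in> W" and a: "a \<in> carrier G" and C: "C \<subseteq> carrier G"
    using Ca ts closedin_subset by (auto simp: W_def closedin_def)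
  let ?M = "{z \<in> topspace (prod_topology (topo G) (topo G)). (\<lambda>(x, y). x \<otimes>\<^bsub>G\<^esub> y) z \<in> W}"
  have "openin (prod_topology (topo G) (topo G)) ?M"
    by (rule openin_continuous_map_preimage[OF _ W])
      (use assms in \<open>simp add: topological_group_def\<close>)
  moreover have "(a, \<one>\<^bsub>G\<^esub>) \<in> ?M"
    using aW a by (simp add: ts)
  ultimately obtain P N where P: "openin (topo G) P" "a \<in> P"
    and N: "openin (topo G) N" "\<one>\<^bsub>G\<^esub> \<in> N" and PN: "P \<times> N \<subseteq> ?M"
    unfolding openin_prod_topology_alt by meson
  \<comment> \<open>\<open>x\<close> belongs to \<open>c N\<^sup>-\<^sup>1\<close> if and only if \<open>x\<^sup>-\<^sup>1 c\<close> belongs to \<open>N\<close>\<close>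
  define V where "V = (\<Union>c\<in>C. {x \<in> topspace (topo G). inv\<^bsub>G\<^esub> x \<otimes>\<^bsub>G\<^esub> c \<in> N})"
  have "openin (topo G) {x \<in> topspace (topo G). inv\<^bsub>G\<^esub> x \<otimes>\<^bsub>G\<^esub> c \<in> N}" if "c \<in> C" for c
    using that C ts
    by (intro openin_continuous_map_preimage[OF _ N(1)] continuous_map_group_mult[OF assms]
        continuous_map_group_inv[OF assms]) auto
  then have "openin (topo G) V"
    unfolding V_def by blast
  moreover have "C \<subseteq> V"
  proof
    fix c assume c: "c \<in> C"
    then have "c \<in> topspace (topo G)" and "inv\<^bsub>G\<^esub> c \<otimes>\<^bsub>G\<^esub> c \<in> N"
      using C N(2) ts by auto
    then show "c \<in> V"
      unfolding V_def using c by blast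
  qed
  moreover have "disjnt P V"
  proof -
    have False if "x \<in> P" "c \<in> C" "x \<in> carrier G" "inv\<^bsub>G\<^esub> x \<otimes>\<^bsub>G\<^esub> c \<in> N" for x c
    proof -
      have "(x, inv\<^bsub>G\<^esub> x \<otimes>\<^bsub>G\<^esub> c) \<in> ?M"
        using PN that by blast
      then have "x \<otimes>\<^bsub>G\<^esub> (inv\<^bsub>G\<^esub> x \<otimes>\<^bsub>G\<^esub> c) \<in> W"
        by simp
      moreover have "c \<in> carrier G"
        using C \<open>c \<in> C\<close> by blast
      then have "x \<otimes>\<^bsub>G\<^esub> (inv\<^bsub>G\<^esub> x \<otimes>\<^bsub>G\<^esub> c) = c"
        using \<open>x \<in> carrier G\<close> by (simp flip: m_assoc)
      ultimately show False
        using that by (simp add: W_def)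
    qed
    then show ?thesis
      unfolding V_def disjnt_def ts by blast
  qed
  ultimately show "\<exists>U V. openin (topo G) U \<and> openin (topo G) V \<and> a \<in> U \<and> C \<subseteq> V \<and> disjnt U V"
    using P by blast
qed

text \<open>In a general space local compactness provides just one compact neighbourhood of each point, while
  the exponential law below uses arbitrarily small ones; regularity bridges the gap.\<close>

lemma compactin_neighbourhood_base_topological_group:
  assumes "topological_group B" "locally_compact_space (topo B)"
  shows "neighbourhood_base_of (compactin (topo B)) (topo B)"
  using assms locally_compact_imp_neighbourhood_base topological_group_imp_regular_space by blast

section \<open>The exponential law for the compact-open topology\<close>

lemma topspace_compact_open_topology: "topspace (compact_open_topology S T) = continuous_maps S T"
proof -
  \<comment> \<open>the subbasic set given by the empty compact set is everything\<close>
  have "continuous_maps S T = {f \<in> continuous_maps S T. f ` {} \<subseteq> {}}"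
    by simp
  then have "continuous_maps S T \<in> {{f \<in> continuous_maps S T. f ` K \<subseteq> U} | K U. compactin S K \<and> openin T U}"
    using compactin_empty openin_empty by blast
  then show ?thesis
    unfolding compact_open_topology_def topology_generated_by_topspace by blast
qed

lemma openin_compact_open_topology_subbasis:
  assumes "compactin S K" "openin T U"
  shows "openin (compact_open_topology S T) {f \<in> continuous_maps S T. f ` K \<subseteq> U}"
  unfolding compact_open_topology_def using assms by (intro topology_generated_by_Basis) blast

text \<open>The exponential law. From left to right, evaluation is continuous because a point of \<open>S\<close> has
  a compact neighbourhood inside any given open one; from right to left, the tube lemma applies to
  \<open>K \<times> {a}\<close> for compact \<open>K\<close>.\<close>

lemma continuous_map_compact_open_topology_iff:
  assumes S: "neighbourhood_base_of (compactin S) S"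
  shows "continuous_map A (compact_open_topology S T) F \<longleftrightarrow>
    F \<in> topspace A \<rightarrow> extensional (topspace S) \<and>
    continuous_map (prod_topology S A) T (\<lambda>(s, a). F a s)"
proof (intro iffI conjI)
  assume F: "continuous_map A (compact_open_topology S T) F"
  then have Fa: "F a \<in> continuous_maps S T" if "a \<in> topspace A" for a
    using that by (auto simp: continuous_map_def topspace_compact_open_topology)
  then show "F \<in> topspace A \<rightarrow> extensional (topspace S)"
    by (auto simp: continuous_maps_def)
  show "continuous_map (prod_topology S A) T (\<lambda>(s, a). F a s)"
    unfolding continuous_map_def
  proof (intro conjI allI impI)
    show "(\<lambda>(s, a). F a s) \<in> topspace (prod_topology S A) \<rightarrow> topspace T"
      using Fa by (auto simp: continuous_maps_def continuous_map_def Pi_iff)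
  next
    fix U assume U: "openin T U"
    show "openin (prod_topology S A) {z \<in> topspace (prod_topology S A). (case z of (s, a) \<Rightarrow> F a s) \<in> U}"
      (is "openin _ ?P")
      unfolding openin_prod_topology_alt[of S A ?P]
    proof (intro allI impI)
      fix s a assume "(s, a) \<in> ?P"
      then have s: "s \<in> topspace S" and a: "a \<in> topspace A" and FU: "F a s \<in> U"
        by auto
      have "openin S {x \<in> topspace S. F a x \<in> U}"
        by (rule openin_continuous_map_preimage[OF _ U]) (use Fa[OF a] in \<open>simp add: continuous_maps_def\<close>)
      then obtain V K where V: "openin S V" "compactin S K" "s \<in> V" "V \<subseteq> K"
        and K: "K \<subseteq> {x \<in> topspace S. F a x \<in> U}"
        using S s FU unfolding neighbourhood_base_of by (metis (mono_tags, lifting) mem_Collect_eq)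
      let ?O = "{a' \<in> topspace A. F a' \<in> {f \<in> continuous_maps S T. f ` K \<subseteq> U}}"
      have "openin A ?O"
        by (rule openin_continuous_map_preimage[OF F openin_compact_open_topology_subbasis[OF V(2) U]])
      moreover have "a \<in> ?O"
        using a K Fa by auto
      moreover have "V \<times> ?O \<subseteq> ?P"
        using V openin_subset by fastforce
      ultimately show "\<exists>V O'. openin S V \<and> openin A O' \<and> s \<in> V \<and> a \<in> O' \<and> V \<times> O' \<subseteq> ?P"
        using V by blast
    qed
  qed
next
  assume F: "F \<in> topspace A \<rightarrow> extensional (topspace S) \<and>
    continuous_map (prod_topology S A) T (\<lambda>(s, a). F a s)"
  have Fa: "F a \<in> continuous_maps S T" if a: "a \<in> topspace A" for a
  proof -
    have "continuous_map S (prod_topology S A) (\<lambda>s. (s, a))"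
      using a by (intro continuous_map_pairedI) auto
    then have "continuous_map S T ((\<lambda>(s, a). F a s) \<circ> (\<lambda>s. (s, a)))"
      using F by (blast intro: continuous_map_compose)
    then show ?thesis
      using F a by (auto simp: continuous_maps_def o_def)
  qed
  show "continuous_map A (compact_open_topology S T) F"
    unfolding compact_open_topology_def
  proof (rule continuous_on_generated_topo)
    show "F ` topspace A \<subseteq> \<Union> {{f \<in> continuous_maps S T. f ` K \<subseteq> U} | K U. compactin S K \<and> openin T U}"
      using Fa topspace_compact_open_topology[of S T]
      unfolding compact_open_topology_def topology_generated_by_topspace by blast
  next
    fix W assume "W \<in> {{f \<in> continuous_maps S T. f ` K \<subseteq> U} | K U. compactin S K \<and> openin T U}"
    then obtain K U where K: "compactin S K" and U: "openin T U"
      and W: "W = {f \<in> continuous_maps S T. f ` K \<subseteq> U}"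
      by blast
    let ?P = "{z \<in> topspace (prod_topology S A). (case z of (s, a) \<Rightarrow> F a s) \<in> U}"
    have P: "openin (prod_topology S A) ?P"
      using F U by (blast intro: openin_continuous_map_preimage)
    show "openin A (F -` W \<inter> topspace A)"
    proof (subst openin_subopen, intro ballI)
      fix a assume a: "a \<in> F -` W \<inter> topspace A"
      have Ka: "K \<times> {a} \<subseteq> ?P"
        using a W compactin_subset_topspace[OF K] by auto
      have "compactin A {a}"
        using a by simp
      from Wallace_theorem_prod_topology[OF K this P Ka] obtain V O'
        where V: "openin S V" "openin A O'" "K \<subseteq> V" "{a} \<subseteq> O'" "V \<times> O' \<subseteq> ?P" .
      have "O' \<subseteq> F -` W \<inter> topspace A"
      proof
        fix a' assume a': "a' \<in> O'"
        then have "a' \<in> topspace A"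
          using V openin_subset by blast
        moreover have "F a' ` K \<subseteq> U"
          using V a' by fastforce
        ultimately show "a' \<in> F -` W \<inter> topspace A"
          using Fa W by auto
      qed
      then show "\<exists>O'. openin A O' \<and> a \<in> O' \<and> O' \<subseteq> F -` W \<inter> topspace A"
        using V by blast
    qed
  qed
qed

lemma continuous_map_pullback_topology_iff:
  "continuous_map A (pullback_topology C \<phi> T) f \<longleftrightarrow>
     f \<in> topspace A \<rightarrow> C \<and> continuous_map A T (\<lambda>a. \<phi> (f a))"
proof (intro iffI conjI)
  assume f: "continuous_map A (pullback_topology C \<phi> T) f"
  then show "f \<in> topspace A \<rightarrow> C"
    by (auto simp: continuous_map_def topspace_pullback_topology)
  have "continuous_map (pullback_topology C \<phi> T) T (id \<circ> \<phi>)"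
    by (intro continuous_map_pullback) simp
  from continuous_map_compose[OF f this] show "continuous_map A T (\<lambda>a. \<phi> (f a))"
    by (simp add: o_def)
next
  assume "f \<in> topspace A \<rightarrow> C \<and> continuous_map A T (\<lambda>a. \<phi> (f a))"
  then show "continuous_map A (pullback_topology C \<phi> T) f"
    by (intro continuous_map_pullback') (auto simp: o_def)
qed

section \<open>Groups with an action\<close>

lemma group_cong:
  assumes "carrier H = carrier G" "monoid.mult H = monoid.mult G" "one H = one G"
  shows "group H \<longleftrightarrow> group G"
  unfolding group_def group_axioms_def monoid_def Units_def by (simp add: assms)

text \<open>Bijectivity of the maps \<open>a b\<close> is automatic: \<open>a (inv b)\<close> is a two-sided inverse. This
  reduces the verification of an action to equations between elements.\<close>

lemma hom_AutoGroup_iff: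
  assumes B: "group B" and X: "group X"
  shows "a \<in> hom B (AutoGroup X) \<longleftrightarrow>
    (\<forall>b\<in>carrier B. a b \<in> hom X X \<inter> extensional (carrier X)) \<and>
    (\<forall>x\<in>carrier X. a \<one>\<^bsub>B\<^esub> x = x) \<and>
    (\<forall>b\<in>carrier B. \<forall>c\<in>carrier B. \<forall>x\<in>carrier X. a (b \<otimes>\<^bsub>B\<^esub> c) x = a b (a c x))"
    (is "?L \<longleftrightarrow> ?R")
proof
  assume L: ?L
  then have au: "a b \<in> auto X" if "b \<in> carrier B" for b
    using that by (auto simp: hom_def AutoGroup_def)
  have "a (b \<otimes>\<^bsub>B\<^esub> c) = compose (carrier X) (a b) (a c)" if "b \<in> carrier B" "c \<in> carrier B" for b c
    using L that au by (auto simp: hom_def AutoGroup_def BijGroup_def auto_def)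
  moreover have "a \<one>\<^bsub>B\<^esub> = \<one>\<^bsub>AutoGroup X\<^esub>"
    using L B X by (simp add: hom_one group.AutoGroup)
  ultimately show ?R
    using au by (auto simp: AutoGroup_def BijGroup_def auto_def Bij_def compose_def)
next
  assume R: ?R
  have au: "a b \<in> auto X" if b: "b \<in> carrier B" for b
  proof -
    let ?c = "inv\<^bsub>B\<^esub> b"
    have c: "?c \<in> carrier B"
      using B b by (simp add: group.inv_closed)
    have bc: "b \<otimes>\<^bsub>B\<^esub> ?c = \<one>\<^bsub>B\<^esub>" "?c \<otimes>\<^bsub>B\<^esub> b = \<one>\<^bsub>B\<^esub>"
      using B b by (simp_all add: group.r_inv group.l_inv)
    have cl: "a b x \<in> carrier X" "a ?c x \<in> carrier X" if "x \<in> carrier X" for x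
      using R b c that by (auto simp: hom_def)
    have "a b (a ?c x) = x" "a ?c (a b x) = x" if "x \<in> carrier X" for x
      using R b c bc that by metis+
    then have "bij_betw (a b) (carrier X) (carrier X)"
      by (intro bij_betw_byWitness[where f' = "a ?c"]) (use cl in auto)
    then show ?thesis
      using R b by (auto simp: auto_def Bij_def)
  qed
  have "a (b \<otimes>\<^bsub>B\<^esub> c) = compose (carrier X) (a b) (a c)" if "b \<in> carrier B" "c \<in> carrier B" for b c
  proof (rule extensionalityI[where A = "carrier X"])
    show "a (b \<otimes>\<^bsub>B\<^esub> c) \<in> extensional (carrier X)"
      using R that B by (meson IntE group.is_monoid monoid.m_closed)
  qed (use R that in \<open>auto simp: compose_def\<close>)
  then show ?L
    using au by (auto simp: hom_def AutoGroup_def BijGroup_def auto_def)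
qed

lemma acts_by_continuous_automorphismsD:
  assumes "acts_by_continuous_automorphisms B G"
  shows "act G \<in> hom B (AutoGroup G)"
    and "b \<in> carrier B \<Longrightarrow> continuous_map (topo G) (topo G) (act G b)"
  using assms by (simp_all add: acts_by_continuous_automorphisms_def)

text \<open>A stable subgroup of \<open>X\<close> with a topology of its own, in general finer than the induced one.
  Both \<open>t(G)\<close> and \<open>t\<^sup>\<infinity>(G)\<close> have this form, so that their algebraic part is treated
  once.\<close>

definition sub_action :: "('b, 'a) actgroup \<Rightarrow> 'a set \<Rightarrow> 'a topology \<Rightarrow> ('b, 'a) actgroup" where
  "sub_action X C T =
     \<lparr>carrier = C, monoid.mult = monoid.mult X, one = one X, topo = T,
      act = (\<lambda>b. restrict (act X b) C)\<rparr>"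

lemma sub_action_simps [simp]:
  "carrier (sub_action X C T) = C" "monoid.mult (sub_action X C T) = monoid.mult X"
  "one (sub_action X C T) = one X" "topo (sub_action X C T) = T"
  "act (sub_action X C T) = (\<lambda>b. restrict (act X b) C)"
  by (simp_all add: sub_action_def)

lemma group_sub_action:
  assumes X: "group X" and C: "subgroup C X"
  shows "group (sub_action X C T)"
    and "x \<in> C \<Longrightarrow> inv\<^bsub>sub_action X C T\<^esub> x = inv\<^bsub>X\<^esub> x"
proof -
  have "group (X\<lparr>carrier := C\<rparr>)"
    using X C by (simp add: subgroup.subgroup_is_group)
  then show "group (sub_action X C T)"
    using group_cong[of "sub_action X C T" "X\<lparr>carrier := C\<rparr>"] by simp
  have "inv\<^bsub>sub_action X C T\<^esub> x = inv\<^bsub>X\<lparr>carrier := C\<rparr>\<^esub> x" for x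
    by (simp add: m_inv_def)
  then show "x \<in> C \<Longrightarrow> inv\<^bsub>sub_action X C T\<^esub> x = inv\<^bsub>X\<^esub> x"
    using X C by (simp add: group.m_inv_consistent)
qed

lemma topological_group_sub_action:
  assumes "group X" "subgroup C X" "topspace T = C"
    and "continuous_map (prod_topology T T) T (\<lambda>(x, y). x \<otimes>\<^bsub>X\<^esub> y)"
    and "continuous_map T T (\<lambda>x. inv\<^bsub>X\<^esub> x)"
  shows "topological_group (sub_action X C T)"
proof -
  have "continuous_map T T (\<lambda>x. inv\<^bsub>sub_action X C T\<^esub> x)"
    using assms(5) by (rule continuous_map_eq) (simp add: assms group_sub_action)
  then show ?thesis
    using assms by (simp add: topological_group_def group_sub_action)
qed

lemma act_sub_action_hom:
  assumes B: "group B" and X: "group X" and act: "act X \<in> hom B (AutoGroup X)"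
    and C: "subgroup C X" and stable: "\<And>b x. b \<in> carrier B \<Longrightarrow> x \<in> C \<Longrightarrow> act X b x \<in> C"
  shows "act (sub_action X C T) \<in> hom B (AutoGroup (sub_action X C T))"
proof -
  interpret C: subgroup C X by (rule C)
  have CX: "x \<in> carrier X" if "x \<in> C" for x
    using that by (rule C.mem_carrier)
  have R: "\<forall>b\<in>carrier B. act X b \<in> hom X X \<inter> extensional (carrier X)"
    "\<forall>x\<in>carrier X. act X \<one>\<^bsub>B\<^esub> x = x"
    "\<forall>b\<in>carrier B. \<forall>c\<in>carrier B. \<forall>x\<in>carrier X. act X (b \<otimes>\<^bsub>B\<^esub> c) x = act X b (act X c x)"
    using act hom_AutoGroup_iff[OF B X] by blast+
  show ?thesis
    unfolding hom_AutoGroup_iff[OF B group_sub_action(1)[OF X C]]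
    using R stable CX by (auto simp: hom_def Pi_iff)
qed

lemma group_actD:
  assumes "group B" "group X" "act X \<in> hom B (AutoGroup X)"
  shows "b \<in> carrier B \<Longrightarrow> x \<in> carrier X \<Longrightarrow> act X b x \<in> carrier X"
    and "b \<in> carrier B \<Longrightarrow> x \<in> carrier X \<Longrightarrow> y \<in> carrier X \<Longrightarrow>
      act X b (x \<otimes>\<^bsub>X\<^esub> y) = act X b x \<otimes>\<^bsub>X\<^esub> act X b y"
    and "b \<in> carrier B \<Longrightarrow> act X b \<one>\<^bsub>X\<^esub> = \<one>\<^bsub>X\<^esub>"
    and "b \<in> carrier B \<Longrightarrow> x \<in> carrier X \<Longrightarrow> act X b (inv\<^bsub>X\<^esub> x) = inv\<^bsub>X\<^esub> act X b x"
    and "x \<in> carrier X \<Longrightarrow> act X \<one>\<^bsub>B\<^esub> x = x"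
    and "b \<in> carrier B \<Longrightarrow> c \<in> carrier B \<Longrightarrow> x \<in> carrier X \<Longrightarrow>
      act X b (act X c x) = act X (b \<otimes>\<^bsub>B\<^esub> c) x"
proof -
  have R: "\<forall>b\<in>carrier B. act X b \<in> hom X X \<inter> extensional (carrier X)"
    "\<forall>x\<in>carrier X. act X \<one>\<^bsub>B\<^esub> x = x"
    "\<forall>b\<in>carrier B. \<forall>c\<in>carrier B. \<forall>x\<in>carrier X. act X (b \<otimes>\<^bsub>B\<^esub> c) x = act X b (act X c x)"
    using assms hom_AutoGroup_iff by blast+
  have h: "group_hom X X (act X b)" if "b \<in> carrier B" for b
    using R that assms by (simp add: group_hom_def group_hom_axioms_def)
  show "b \<in> carrier B \<Longrightarrow> x \<in> carrier X \<Longrightarrow> act X b x \<in> carrier X"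
    "b \<in> carrier B \<Longrightarrow> x \<in> carrier X \<Longrightarrow> y \<in> carrier X \<Longrightarrow>
      act X b (x \<otimes>\<^bsub>X\<^esub> y) = act X b x \<otimes>\<^bsub>X\<^esub> act X b y"
    "b \<in> carrier B \<Longrightarrow> act X b \<one>\<^bsub>X\<^esub> = \<one>\<^bsub>X\<^esub>"
    "b \<in> carrier B \<Longrightarrow> x \<in> carrier X \<Longrightarrow> act X b (inv\<^bsub>X\<^esub> x) = inv\<^bsub>X\<^esub> act X b x"
    using group_hom.hom_closed[OF h] group_hom.hom_mult[OF h] group_hom.hom_one[OF h]
      group_hom.hom_inv[OF h] by simp_all
  show "x \<in> carrier X \<Longrightarrow> act X \<one>\<^bsub>B\<^esub> x = x"
    "b \<in> carrier B \<Longrightarrow> c \<in> carrier B \<Longrightarrow> x \<in> carrier X \<Longrightarrow>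
      act X b (act X c x) = act X (b \<otimes>\<^bsub>B\<^esub> c) x"
    using R by simp_all
qed

section \<open>The refinement \<open>t(G)\<close>\<close>

lemma t_step_eq_sub_action:
  "t_step B G = sub_action G (continuous_elements B G)
     (pullback_topology (continuous_elements B G) (\<lambda>g. \<lambda>b\<in>carrier B. act G b g)
       (compact_open_topology (topo B) (topo G)))"
  by (simp add: t_step_def sub_action_def)

text \<open>The universal property of the topology \<open>\<tau>\<^sub>1\<close>, obtained by transporting the exponential law
  along \<open>G\<^sub>1 \<rightarrow> C(B, G)\<close>. That the values of \<open>f\<close> lie in \<open>G\<^sub>1\<close> follows by freezing
  \<open>a\<close> in the continuous map \<open>(b, a) \<mapsto> b \<cdot> f a\<close>. Everything below about
  \<open>t(G)\<close> is derived from this equivalence without looking at compact sets again.\<close>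

lemma continuous_map_t_step_iff:
  assumes B: "topological_group B" "locally_compact_space (topo B)"
  shows "continuous_map A (topo (t_step B G)) f \<longleftrightarrow>
    f \<in> topspace A \<rightarrow> carrier G \<and>
    continuous_map (prod_topology (topo B) A) (topo G) (\<lambda>(b, a). act G b (f a))"
    (is "?L \<longleftrightarrow> ?R")
proof -
  have ts: "topspace (topo B) = carrier B"
    using B by (simp add: topological_groupD)
  have eq: "continuous_map (prod_topology (topo B) A) (topo G) (\<lambda>(s, a). (\<lambda>b\<in>carrier B. act G b (f a)) s) \<longleftrightarrow>
    continuous_map (prod_topology (topo B) A) (topo G) (\<lambda>(b, a). act G b (f a))"
    by (rule iffI; erule continuous_map_eq) (auto simp: ts)
  have "?L \<longleftrightarrow> f \<in> topspace A \<rightarrow> continuous_elements B G \<and>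
      continuous_map A (compact_open_topology (topo B) (topo G)) (\<lambda>a. \<lambda>b\<in>carrier B. act G b (f a))"
    by (simp add: t_step_def continuous_map_pullback_topology_iff)
  also have "\<dots> \<longleftrightarrow> f \<in> topspace A \<rightarrow> continuous_elements B G \<and>
      continuous_map (prod_topology (topo B) A) (topo G) (\<lambda>(b, a). act G b (f a))"
    unfolding continuous_map_compact_open_topology_iff[OF compactin_neighbourhood_base_topological_group[OF B]] eq
    by (simp add: ts)
  also have "\<dots> \<longleftrightarrow> ?R"
  proof (intro iffI conjI; elim conjE)
    assume "f \<in> topspace A \<rightarrow> continuous_elements B G"
    then show "f \<in> topspace A \<rightarrow> carrier G"
      by (auto simp: continuous_elements_def)
  next
    assume f: "f \<in> topspace A \<rightarrow> carrier G"
      and cont: "continuous_map (prod_topology (topo B) A) (topo G) (\<lambda>(b, a). act G b (f a))"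
    have "continuous_map (topo B) (topo G) (\<lambda>b. act G b (f a))" if "a \<in> topspace A" for a
    proof -
      have "continuous_map (topo B) (prod_topology (topo B) A) (\<lambda>b. (b, a))"
        using that by (intro continuous_map_pairedI) auto
      from continuous_map_compose[OF this cont] show ?thesis
        by (simp add: o_def)
    qed
    then show "f \<in> topspace A \<rightarrow> continuous_elements B G"
      using f by (auto simp: continuous_elements_def)
  qed
  finally show ?thesis .
qed

text \<open>The orbit maps of continuous elements are points of \<open>C(B, G)\<close>, so pulling back its topology
  loses no element of \<open>G\<^sub>1\<close>.\<close>

lemma topspace_t_step:
  assumes "topological_group B"
  shows "topspace (topo (t_step B G)) = continuous_elements B G"
proof -
  have "(\<lambda>b\<in>carrier B. act G b g) \<in> continuous_maps (topo B) (topo G)"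
    if "g \<in> continuous_elements B G" for g
  proof -
    have "continuous_map (topo B) (topo G) (\<lambda>b\<in>carrier B. act G b g)"
      by (rule continuous_map_eq[where f = "\<lambda>b. act G b g"])
        (use that assms in \<open>auto simp: continuous_elements_def topological_groupD\<close>)
    then show ?thesis
      using assms by (simp add: continuous_maps_def topological_groupD)
  qed
  then show ?thesis
    by (auto simp: t_step_def topspace_pullback_topology topspace_compact_open_topology)
qed

text \<open>The gain from passing to \<open>t(G)\<close>: the action becomes jointly continuous, although only as a
  map \<open>B \<times> t(G) \<rightarrow> G\<close>.\<close>

lemma continuous_map_act_t_step:
  assumes B: "topological_group B" "locally_compact_space (topo B)"
    and \<beta>: "continuous_map A (topo B) \<beta>" and f: "continuous_map A (topo (t_step B G)) f"
  shows "continuous_map A (topo G) (\<lambda>a. act G (\<beta> a) (f a))"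
proof -
  have "continuous_map (prod_topology (topo B) A) (topo G) (\<lambda>(b, a). act G b (f a))"
    using f by (simp add: continuous_map_t_step_iff[OF B])
  moreover have "continuous_map A (prod_topology (topo B) A) (\<lambda>a. (\<beta> a, a))"
    using \<beta> by (intro continuous_map_pairedI) (auto simp: continuous_map_id[unfolded id_def])
  ultimately have "continuous_map A (topo G) ((\<lambda>(b, a). act G b (f a)) \<circ> (\<lambda>a. (\<beta> a, a)))"
    by (blast intro: continuous_map_compose)
  then show ?thesis
    by (simp add: o_def)
qed

lemma subgroup_continuous_elements:
  assumes B: "group B" and G: "topological_group G" and act: "act G \<in> hom B (AutoGroup G)"
    and tsB: "topspace (topo B) = carrier B"
  shows "subgroup (continuous_elements B G) G"
proof -
  have gG: "group G" using G by (simp add: topological_groupD)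
  interpret G: group G by (rule gG)
  note actD = group_actD[OF B gG act]
  show ?thesis
  proof (rule G.subgroupI)
    show "continuous_elements B G \<subseteq> carrier G"
      by (auto simp: continuous_elements_def)
    have "continuous_map (topo B) (topo G) (\<lambda>b. act G b \<one>\<^bsub>G\<^esub>)"
      by (rule continuous_map_eq[where f = "\<lambda>b. \<one>\<^bsub>G\<^esub>"])
        (use G actD in \<open>auto simp: tsB topological_groupD\<close>)
    then show "continuous_elements B G \<noteq> {}"
      by (auto simp: continuous_elements_def)
  next
    fix g assume g: "g \<in> continuous_elements B G"
    have "continuous_map (topo B) (topo G) (\<lambda>b. act G b (inv\<^bsub>G\<^esub> g))"
      by (rule continuous_map_eq[where f = "\<lambda>b. inv\<^bsub>G\<^esub> act G b g", OF continuous_map_group_inv[OF G]])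
        (use g actD in \<open>auto simp: tsB continuous_elements_def\<close>)
    then show "inv\<^bsub>G\<^esub> g \<in> continuous_elements B G"
      using g by (auto simp: continuous_elements_def)
  next
    fix g h assume g: "g \<in> continuous_elements B G" and h: "h \<in> continuous_elements B G"
    have "continuous_map (topo B) (topo G) (\<lambda>b. act G b (g \<otimes>\<^bsub>G\<^esub> h))"
      by (rule continuous_map_eq[where f = "\<lambda>b. act G b g \<otimes>\<^bsub>G\<^esub> act G b h",
            OF continuous_map_group_mult[OF G]])
        (use g h actD in \<open>auto simp: tsB continuous_elements_def\<close>)
    then show "g \<otimes>\<^bsub>G\<^esub> h \<in> continuous_elements B G"
      using g h by (auto simp: continuous_elements_def)
  qed
qed

text \<open>The orbit map of \<open>c \<cdot> g\<close> is that of \<open>g\<close> preceded by right translation by \<open>c\<close>.\<close>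

lemma continuous_elements_stable:
  assumes B: "topological_group B" and G: "group G" and act: "act G \<in> hom B (AutoGroup G)"
    and c: "c \<in> carrier B" and g: "g \<in> continuous_elements B G"
  shows "act G c g \<in> continuous_elements B G"
proof -
  note actD = group_actD[OF topological_groupD(1)[OF B] G act]
  have gG: "g \<in> carrier G" and cont: "continuous_map (topo B) (topo G) (\<lambda>b. act G b g)"
    using g by (auto simp: continuous_elements_def)
  have "continuous_map (topo B) (topo B) (\<lambda>b. b \<otimes>\<^bsub>B\<^esub> c)"
    by (rule continuous_map_group_mult[OF B])
      (use B c in \<open>auto simp: topological_groupD continuous_map_id[unfolded id_def]\<close>)
  from continuous_map_compose[OF this cont]
  have "continuous_map (topo B) (topo G) (\<lambda>b. act G (b \<otimes>\<^bsub>B\<^esub> c) g)"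
    by (simp add: o_def)
  then have "continuous_map (topo B) (topo G) (\<lambda>b. act G b (act G c g))"
    by (rule continuous_map_eq) (use B c gG actD in \<open>auto simp: topological_groupD\<close>)
  then show ?thesis
    using actD(1)[OF c gG] by (simp add: continuous_elements_def)
qed

text \<open>By the universal property each continuity claim is one about a map \<open>B \<times> A \<rightarrow> G\<close>, for example
  \<open>(b, x, y) \<mapsto> (b \<cdot> x) (b \<cdot> y)\<close> for multiplication, and such maps are built from
  \<open>B \<times> t(G) \<rightarrow> G\<close> and the operations of \<open>G\<close> and \<open>B\<close>.\<close>

lemma t_step_action:
  assumes B: "topological_group B" "locally_compact_space (topo B)"
    and G: "topological_group G" "acts_by_continuous_automorphisms B G"
  shows "topological_group (t_step B G)" "acts_by_continuous_automorphisms B (t_step B G)"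
proof -
  have gB: "group B" and tsB: "topspace (topo B) = carrier B"
    and gG: "group G" and act: "act G \<in> hom B (AutoGroup G)"
    using B G by (simp_all add: topological_groupD acts_by_continuous_automorphismsD)
  interpret G: group G by (rule gG)
  note actD = group_actD[OF gB gG act]
  let ?C = "continuous_elements B G" and ?T = "topo (t_step B G)"
  have sub: "subgroup ?C G"
    by (rule subgroup_continuous_elements[OF gB G(1) act tsB])
  have CG: "x \<in> carrier G" if "x \<in> ?C" for x
    using that by (simp add: continuous_elements_def)
  have ts: "topspace ?T = ?C"
    by (rule topspace_t_step[OF B(1)])
  have eq: "t_step B G = sub_action G ?C ?T"
    by (simp add: t_step_eq_sub_action)
  note ev = continuous_map_act_t_step[OF B]
  have mult: "continuous_map (prod_topology ?T ?T) ?T (\<lambda>(x, y). x \<otimes>\<^bsub>G\<^esub> y)"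
    unfolding continuous_map_t_step_iff[OF B]
  proof
    show "(\<lambda>(x, y). x \<otimes>\<^bsub>G\<^esub> y) \<in> topspace (prod_topology ?T ?T) \<rightarrow> carrier G"
      using CG by (auto simp: ts)
    let ?A = "prod_topology (topo B) (prod_topology ?T ?T)"
    have proj: "continuous_map ?A (topo B) (\<lambda>z. fst z)"
      "continuous_map ?A ?T (\<lambda>z. fst (snd z))" "continuous_map ?A ?T (\<lambda>z. snd (snd z))"
      by (rule continuous_map_fst continuous_map_fst_of[OF continuous_map_snd, unfolded o_def]
          continuous_map_snd_of[OF continuous_map_snd, unfolded o_def])+
    have "continuous_map ?A (topo G) (\<lambda>z. act G (fst z) (fst (snd z)) \<otimes>\<^bsub>G\<^esub> act G (fst z) (snd (snd z)))"
      by (intro continuous_map_group_mult[OF G(1)] ev proj)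
    then show "continuous_map ?A (topo G) (\<lambda>(b, a). act G b (case a of (x, y) \<Rightarrow> x \<otimes>\<^bsub>G\<^esub> y))"
      by (rule continuous_map_eq) (use actD CG in \<open>auto simp: ts tsB\<close>)
  qed
  have inv: "continuous_map ?T ?T (\<lambda>x. inv\<^bsub>G\<^esub> x)"
    unfolding continuous_map_t_step_iff[OF B]
  proof
    show "(\<lambda>x. inv\<^bsub>G\<^esub> x) \<in> topspace ?T \<rightarrow> carrier G"
      using CG by (auto simp: ts)
    have "continuous_map (prod_topology (topo B) ?T) (topo G) (\<lambda>z. inv\<^bsub>G\<^esub> act G (fst z) (snd z))"
      by (intro continuous_map_group_inv[OF G(1)] ev continuous_map_fst continuous_map_snd)
    then show "continuous_map (prod_topology (topo B) ?T) (topo G) (\<lambda>(b, x). act G b (inv\<^bsub>G\<^esub> x))"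
      by (rule continuous_map_eq) (use actD CG in \<open>auto simp: ts tsB\<close>)
  qed
  show "topological_group (t_step B G)"
    by (subst eq) (rule topological_group_sub_action[OF gG sub ts mult inv])
  have "continuous_map ?T ?T (act G c)" if c: "c \<in> carrier B" for c
    unfolding continuous_map_t_step_iff[OF B]
  proof
    show "act G c \<in> topspace ?T \<rightarrow> carrier G"
      using CG c actD by (auto simp: ts)
    have "continuous_map (prod_topology (topo B) ?T) (topo G) (\<lambda>z. act G (fst z \<otimes>\<^bsub>B\<^esub> c) (snd z))"
      by (intro continuous_map_group_mult[OF B(1)] ev continuous_map_fst continuous_map_snd)
        (use c in \<open>auto simp: tsB\<close>)
    then show "continuous_map (prod_topology (topo B) ?T) (topo G) (\<lambda>(b, x). act G b (act G c x))"
      by (rule continuous_map_eq) (use actD CG c in \<open>auto simp: ts tsB\<close>)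
  qed
  then have "continuous_map ?T ?T (restrict (act G c) ?C)" if "c \<in> carrier B" for c
    by (rule continuous_map_eq) (use that in \<open>auto simp: ts\<close>)
  moreover have "act (sub_action G ?C ?T) \<in> hom B (AutoGroup (sub_action G ?C ?T))"
    by (rule act_sub_action_hom[OF gB gG act sub continuous_elements_stable[OF B(1) gG act]])
  ultimately show "acts_by_continuous_automorphisms B (t_step B G)"
    by (subst eq) (simp add: acts_by_continuous_automorphisms_def)
qed

section \<open>The limit \<open>t\<^sup>\<infinity>(G)\<close>\<close>

lemma t_iter_simps [simp]: "t_iter B 0 G = G" "t_iter B (Suc l) G = t_step B (t_iter B l G)"
  by (simp_all add: t_iter_def)

lemma t_iter_action:
  assumes B: "topological_group B" "locally_compact_space (topo B)"
    and G: "topological_group G" "acts_by_continuous_automorphisms B G"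
  shows "topological_group (t_iter B l G)" "acts_by_continuous_automorphisms B (t_iter B l G)"
  by (induction l) (use G t_step_action[OF B] in auto)

lemma t_iter_structure:
  shows "carrier (t_iter B l G) \<subseteq> carrier G"
    and "monoid.mult (t_iter B l G) = monoid.mult G" "one (t_iter B l G) = one G"
    and "g \<in> carrier (t_iter B l G) \<Longrightarrow> act (t_iter B l G) b g = act G b g"
  by (induction l) (auto simp: t_step_def continuous_elements_def)

lemma subgroup_t_iter:
  assumes "group G" "group (t_iter B l G)"
  shows "subgroup (carrier (t_iter B l G)) G"
    and "g \<in> carrier (t_iter B l G) \<Longrightarrow> inv\<^bsub>t_iter B l G\<^esub> g = inv\<^bsub>G\<^esub> g"
proof -
  let ?H = "t_iter B l G"
  interpret G: group G by (rule assms)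
  interpret H: group ?H by (rule assms)
  note s = t_iter_structure[where B = B and l = l and G = G]
  have inv: "inv\<^bsub>?H\<^esub> g = inv\<^bsub>G\<^esub> g" if "g \<in> carrier ?H" for g
    using that s(1) H.l_inv[OF that] H.inv_closed[OF that] G.inv_equality[of "inv\<^bsub>?H\<^esub> g" g]
    unfolding s(2,3) by (metis subsetD)
  show "g \<in> carrier (t_iter B l G) \<Longrightarrow> inv\<^bsub>t_iter B l G\<^esub> g = inv\<^bsub>G\<^esub> g"
    by (rule inv)
  show "subgroup (carrier ?H) G"
  proof (rule G.subgroupI)
    show "inv\<^bsub>G\<^esub> g \<in> carrier ?H" if "g \<in> carrier ?H" for g
      using H.inv_closed[OF that] inv[OF that] by simp
    show "carrier ?H \<noteq> {}"
      using H.one_closed by blast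
  qed (use s(1) H.m_closed s(2) in simp_all)
qed

text \<open>A map with values in \<open>C\<close> has the same preimage for \<open>U\<close> and for its trace \<open>U \<inter> C\<close>, so
  continuity may be tested on either. The traces of the whole spaces cover \<open>C\<close>.\<close>

lemma continuous_map_into_limit_topology_iff:
  assumes C: "C = (\<Inter>l. topspace (T l))"
  shows "continuous_map A (topology_generated_by (\<Union>l. {U \<inter> C | U. openin (T l) U})) f \<longleftrightarrow>
    (\<forall>l. continuous_map A (T l) f)"
    and "topspace (topology_generated_by (\<Union>l. {U \<inter> C | U. openin (T l) U})) = C"
proof -
  have un: "\<Union> (\<Union>l. {U \<inter> C | U. openin (T l) U}) = C"
    unfolding C using openin_topspace by blast
  then show "topspace (topology_generated_by (\<Union>l. {U \<inter> C | U. openin (T l) U})) = C"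
    by simp
  show "continuous_map A (topology_generated_by (\<Union>l. {U \<inter> C | U. openin (T l) U})) f \<longleftrightarrow>
    (\<forall>l. continuous_map A (T l) f)"
    unfolding continuous_on_generated_topo_iff un
  proof (intro iffI conjI allI impI; (elim conjE)?)
    fix l
    assume op: "\<forall>U. U \<in> (\<Union>l. {U \<inter> C | U. openin (T l) U}) \<longrightarrow> openin A (f -` U \<inter> topspace A)"
      and fC: "f ` topspace A \<subseteq> C"
    show "continuous_map A (T l) f"
      unfolding continuous_map_alt
    proof (intro conjI allI impI)
      fix U assume "openin (T l) U"
      then have "openin A (f -` (U \<inter> C) \<inter> topspace A)"
        using op by blast
      moreover have "f -` (U \<inter> C) \<inter> topspace A = f -` U \<inter> topspace A"
        using fC by blast
      ultimately show "openin A (f -` U \<inter> topspace A)"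
        by simp
    qed (use fC C in auto)
  next
    assume cont: "\<forall>l. continuous_map A (T l) f"
    show fC: "f ` topspace A \<subseteq> C"
      using cont unfolding C continuous_map_def by blast
    fix W assume "W \<in> (\<Union>l. {U \<inter> C | U. openin (T l) U})"
    then obtain l U where U: "openin (T l) U" "W = U \<inter> C"
      by blast
    have "f -` W \<inter> topspace A = f -` U \<inter> topspace A"
      using fC U by blast
    then show "openin A (f -` W \<inter> topspace A)"
      using cont U by (simp add: continuous_map_alt)
  qed
qed

lemma t_infty_eq_sub_action:
  "t_infty B G = sub_action G (\<Inter>l. carrier (t_iter B l G)) (topo (t_infty B G))"
  by (simp add: t_infty_def sub_action_def Let_def)

lemma t_infty_simps [simp]:
  "carrier (t_infty B G) = (\<Inter>l. carrier (t_iter B l G))"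
  "monoid.mult (t_infty B G) = monoid.mult G" "one (t_infty B G) = one G"
  "act (t_infty B G) b = restrict (act G b) (\<Inter>l. carrier (t_iter B l G))"
  by (simp_all add: t_infty_def Let_def)

lemma continuous_map_t_infty_iff:
  assumes B: "topological_group B" "locally_compact_space (topo B)"
    and G: "topological_group G" "acts_by_continuous_automorphisms B G"
  shows "continuous_map A (topo (t_infty B G)) f \<longleftrightarrow> (\<forall>l. continuous_map A (topo (t_iter B l G)) f)"
    and "topspace (topo (t_infty B G)) = carrier (t_infty B G)"
proof -
  have C: "(\<Inter>l. carrier (t_iter B l G)) = (\<Inter>l. topspace (topo (t_iter B l G)))"
    using topological_groupD(2)[OF t_iter_action(1)[OF B G]] by simp
  have T: "topo (t_infty B G) = topology_generated_by (\<Union>l. {U \<inter> (\<Inter>l. carrier (t_iter B l G)) | U. openin (topo (t_iter B l G)) U})"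
    by (simp add: t_infty_def Let_def)
  show "continuous_map A (topo (t_infty B G)) f \<longleftrightarrow> (\<forall>l. continuous_map A (topo (t_iter B l G)) f)"
    "topspace (topo (t_infty B G)) = carrier (t_infty B G)"
    unfolding T t_infty_simps using continuous_map_into_limit_topology_iff[OF C] by blast+
qed

text \<open>Each step of the iteration turns the action into a continuous map
  \<open>B \<times> t\<^sup>l\<^sup>+\<^sup>1(G) \<rightarrow> t\<^sup>l(G)\<close>. The loss of one index disappears in the limit.\<close>

lemma pt_object_t_infty:
  assumes B: "topological_group B" "locally_compact_space (topo B)"
    and G: "topological_group G" "acts_by_continuous_automorphisms B G"
  shows "pt_object B (t_infty B G)"
proof -
  have gB: "group B" and tsB: "topspace (topo B) = carrier B"
    and gG: "group G" and act: "act G \<in> hom B (AutoGroup G)"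
    using B G by (simp_all add: topological_groupD acts_by_continuous_automorphismsD)
  interpret G: group G by (rule gG)
  let ?t = "\<lambda>l. t_iter B l G" and ?C = "\<Inter>l. carrier (t_iter B l G)" and ?T = "topo (t_infty B G)"
  note tl = t_iter_action[OF B G]
  note gtl = topological_groupD(1)[OF tl(1)]
  note str = t_iter_structure[where B = B and G = G]
  note cont_iff = continuous_map_t_infty_iff(1)[OF B G]
  have ts: "topspace ?T = ?C"
    using continuous_map_t_infty_iff(2)[OF B G] by simp
  have sub: "subgroup ?C G"
    by (rule G.subgroups_Inter) (use subgroup_t_iter(1)[OF gG gtl] in auto)
  have stable: "act G b x \<in> ?C" if "b \<in> carrier B" "x \<in> ?C" for b x
  proof
    fix l
    have x: "x \<in> carrier (?t l)" using that by blast
    then show "act G b x \<in> carrier (?t l)"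
      using group_actD(1)[OF gB gtl acts_by_continuous_automorphismsD(1)[OF tl(2)] that(1) x]
      by (simp add: str)
  qed
  have proj: "continuous_map A (topo (?t l)) f" if "continuous_map A ?T f" for A :: "'x topology" and f l
    using that by (simp add: cont_iff)
  have mult: "continuous_map (prod_topology ?T ?T) ?T (\<lambda>(x, y). x \<otimes>\<^bsub>G\<^esub> y)"
    unfolding cont_iff
  proof
    fix l
    have "continuous_map (prod_topology ?T ?T) (topo (?t l)) (\<lambda>z. fst z \<otimes>\<^bsub>?t l\<^esub> snd z)"
      by (intro continuous_map_group_mult[OF tl(1)] proj continuous_map_fst continuous_map_snd)
    then show "continuous_map (prod_topology ?T ?T) (topo (?t l)) (\<lambda>(x, y). x \<otimes>\<^bsub>G\<^esub> y)"
      by (simp add: str case_prod_beta')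
  qed
  have inv: "continuous_map ?T ?T (\<lambda>x. inv\<^bsub>G\<^esub> x)"
    unfolding cont_iff
  proof
    fix l
    have "continuous_map ?T (topo (?t l)) (\<lambda>x. inv\<^bsub>?t l\<^esub> x)"
      by (intro continuous_map_group_inv[OF tl(1)] proj) (simp add: continuous_map_id[unfolded id_def])
    then show "continuous_map ?T (topo (?t l)) (\<lambda>x. inv\<^bsub>G\<^esub> x)"
      by (rule continuous_map_eq) (use subgroup_t_iter(2)[OF gG gtl] ts in auto)
  qed
  have "continuous_map (prod_topology (topo B) ?T) ?T (\<lambda>(b, x). restrict (act G b) ?C x)"
    unfolding cont_iff
  proof
    fix l
    have "continuous_map (prod_topology (topo B) ?T) (topo (?t (Suc l))) (\<lambda>z. snd z)"
      by (rule proj[OF continuous_map_snd])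
    then have "continuous_map (prod_topology (topo B) ?T) (topo (t_step B (?t l))) (\<lambda>z. snd z)"
      by simp
    then have "continuous_map (prod_topology (topo B) ?T) (topo (?t l)) (\<lambda>z. act (?t l) (fst z) (snd z))"
      by (intro continuous_map_act_t_step[OF B] continuous_map_fst)
    then show "continuous_map (prod_topology (topo B) ?T) (topo (?t l)) (\<lambda>(b, x). restrict (act G b) ?C x)"
      by (rule continuous_map_eq) (use str(4) ts in auto)
  qed
  then have "pt_object B (sub_action G ?C ?T)"
    using topological_group_sub_action[OF gG sub ts mult inv]
      act_sub_action_hom[OF gB gG act sub stable, of ?T]
    by (simp add: pt_object_def)
  then show ?thesis
    by (subst t_infty_eq_sub_action)
qed

section \<open>Morphisms into \<open>t\<^sup>\<infinity>(G)\<close>\<close>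

lemma pt_objectD:
  assumes "pt_object B X"
  shows "topological_group X" "group X" "topspace (topo X) = carrier X" "act X \<in> hom B (AutoGroup X)"
  using assms by (auto simp: pt_object_def topological_group_def)

lemma pt_object_imp_acts:
  assumes X: "pt_object B X" and B: "topspace (topo B) = carrier B"
  shows "acts_by_continuous_automorphisms B X"
  unfolding acts_by_continuous_automorphisms_def
proof (intro conjI ballI)
  show "act X \<in> hom B (AutoGroup X)"
    using X by (simp add: pt_object_def)
  fix b assume "b \<in> carrier B"
  then show "continuous_map (topo X) (topo X) (act X b)"
    using B continuous_map_action[OF X, of "topo X" "\<lambda>_. b" "\<lambda>x. x"]
    by (simp add: continuous_map_id[unfolded id_def])
qed

lemma pt_homD:
  assumes "f \<in> pt_hom H X Z"
  shows "x \<in> carrier X \<Longrightarrow> f x \<in> carrier Z" "f \<in> extensional (carrier X)"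
    "x \<in> carrier X \<Longrightarrow> y \<in> carrier X \<Longrightarrow> f (x \<otimes>\<^bsub>X\<^esub> y) = f x \<otimes>\<^bsub>Z\<^esub> f y"
    "continuous_map (topo X) (topo Z) f"
    "b \<in> carrier H \<Longrightarrow> x \<in> carrier X \<Longrightarrow> f (act X b x) = act Z b (f x)"
  using assms by (auto simp: pt_hom_def hom_def)

lemma id_pt_hom:
  assumes "group H" "pt_object H X"
  shows "(\<lambda>x\<in>carrier X. x) \<in> pt_hom H X X"
proof -
  have X: "group X" "topspace (topo X) = carrier X" "act X \<in> hom H (AutoGroup X)"
    using assms(2) by (auto simp: pt_object_def topological_group_def)
  have "continuous_map (topo X) (topo X) (\<lambda>x\<in>carrier X. x)"
    by (rule continuous_map_eq[OF continuous_map_id]) (simp add: X)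
  then show ?thesis
    using group_actD(1)[OF assms(1) X(1,3)] X(1)
    by (auto simp: pt_hom_def hom_def group.is_monoid monoid.m_closed)
qed

lemma compose_pt_hom:
  assumes "group B" "pt_object B X" "f \<in> pt_hom B X Y" "g \<in> pt_hom B Y Z"
  shows "compose (carrier X) g f \<in> pt_hom B X Z"
proof -
  have X: "group X" "topspace (topo X) = carrier X" "act X \<in> hom B (AutoGroup X)"
    using assms(2) by (auto simp: pt_object_def topological_group_def)
  have f: "f \<in> hom X Y" "continuous_map (topo X) (topo Y) f"
    "\<forall>b\<in>carrier B. \<forall>x\<in>carrier X. f (act X b x) = act Y b (f x)"
    and g: "g \<in> hom Y Z" "continuous_map (topo Y) (topo Z) g"
    "\<forall>b\<in>carrier B. \<forall>x\<in>carrier Y. g (act Y b x) = act Z b (g x)"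
    using assms(3,4) by (auto simp: pt_hom_def)
  have "continuous_map (topo X) (topo Z) (compose (carrier X) g f)"
    by (rule continuous_map_eq[OF continuous_map_compose[OF f(2) g(2)]])
      (simp add: X compose_def)
  moreover have "compose (carrier X) g f \<in> hom X Z"
    using f(1) g(1) X(1) by (simp add: group.hom_compose)
  moreover have "f x \<in> carrier Y" if "x \<in> carrier X" for x
    using f(1) that by (auto simp: hom_def)
  ultimately show ?thesis
    using f(3) g(3) group_actD(1)[OF assms(1) X(1) X(3)] by (auto simp: pt_hom_def compose_def)
qed

text \<open>If \<open>f : X \<rightarrow> t\<^sup>l(G)\<close> is continuous and equivariant, then
  \<open>(b, x) \<mapsto> b \<cdot> f x = f (b \<cdot> x)\<close> is continuous because \<open>B\<close> acts continuously on
  \<open>X\<close>, so \<open>f\<close> is continuous into \<open>t\<^sup>l\<^sup>+\<^sup>1(G)\<close>. Induction on \<open>l\<close> lifts \<open>f\<close> to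
  the limit.\<close>

lemma pt_hom_t_infty_eq:
  fixes X :: "('b, 'x) actgroup"
  assumes B: "topological_group B" "locally_compact_space (topo B)"
    and G: "topological_group G" "acts_by_continuous_automorphisms B G"
    and X: "pt_object B X"
  shows "pt_hom B X (t_infty B G) = pt_hom B X G"
proof -
  have gB: "group B" and tsB: "topspace (topo B) = carrier B"
    and gX: "group X" and tsX: "topspace (topo X) = carrier X" and actX: "act X \<in> hom B (AutoGroup X)"
    using B X by (auto simp: topological_groupD pt_object_def)
  note cont_iff = continuous_map_t_infty_iff(1)[OF B G]
  have C: "(\<Inter>l. carrier (t_iter B l G)) \<subseteq> carrier G"
    using t_iter_structure(1) by fast
  have lift: "continuous_map (topo X) (topo (t_iter B l G)) f" if f: "f \<in> pt_hom B X G" for f l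
  proof (induction l)
    case 0
    then show ?case
      using f by (simp add: pt_hom_def)
  next
    case (Suc l)
    have maps: "f x \<in> carrier (t_iter B l G)" if "x \<in> carrier X" for x
      using Suc that tsX topological_groupD(2)[OF t_iter_action(1)[OF B G]]
      by (auto simp: continuous_map_def)
    have "continuous_map (prod_topology (topo B) (topo X)) (topo (t_iter B l G))
        (\<lambda>z. f (act X (fst z) (snd z)))"
      using continuous_map_compose[OF continuous_map_action[OF X continuous_map_fst continuous_map_snd] Suc]
      by (simp add: o_def)
    then have "continuous_map (prod_topology (topo B) (topo X)) (topo (t_iter B l G))
        (\<lambda>(b, x). act (t_iter B l G) b (f x))"
      by (rule continuous_map_eq)
        (use f maps in \<open>auto simp: pt_hom_def tsB tsX t_iter_structure(4)\<close>)
    then show ?case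
      using maps by (simp add: continuous_map_t_step_iff[OF B] tsX)
  qed
  have "f \<in> pt_hom B X (t_infty B G)" if f: "f \<in> pt_hom B X G" for f
  proof -
    have cont: "continuous_map (topo X) (topo (t_infty B G)) f"
      using lift[OF f] by (simp add: cont_iff)
    then have "f x \<in> (\<Inter>l. carrier (t_iter B l G))" if "x \<in> carrier X" for x
      using that continuous_map_t_infty_iff(2)[OF B G] tsX by (auto simp: continuous_map_def)
    then show ?thesis
      using f cont by (auto simp: pt_hom_def hom_def)
  qed
  moreover have "f \<in> pt_hom B X G" if f: "f \<in> pt_hom B X (t_infty B G)" for f
  proof -
    have "continuous_map (topo X) (topo (t_infty B G)) f"
      using f by (simp add: pt_hom_def)
    then have "continuous_map (topo X) (topo (t_iter B 0 G)) f"
      unfolding cont_iff by blast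
    then have "continuous_map (topo X) (topo G) f"
      by simp
    moreover have "f x \<in> (\<Inter>l. carrier (t_iter B l G))" if "x \<in> carrier X" for x
      using f that by (auto simp: pt_hom_def hom_def)
    ultimately show ?thesis
      using f C by (auto simp: pt_hom_def hom_def Pi_iff)
  qed
  ultimately show ?thesis
    by blast
qed

section \<open>Restriction along \<open>\<alpha>\<close>\<close>

locale coinduction_along =
  fixes E :: "'e topgroup" and B :: "'b topgroup" and \<alpha> :: "'e \<Rightarrow> 'b"
  assumes E: "topological_group E"
    and B: "topological_group B" "locally_compact_space (topo B)"
    and \<alpha>_hom: "\<alpha> \<in> hom E B"
    and \<alpha>_continuous: "continuous_map (topo E) (topo B) \<alpha>"
begin

lemma group_E: "group E" and group_B: "group B"
  and topspace_E: "topspace (topo E) = carrier E" and topspace_B: "topspace (topo B) = carrier B"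
  using E B by (simp_all add: topological_groupD)

lemma \<alpha>_closed: "e \<in> carrier E \<Longrightarrow> \<alpha> e \<in> carrier B"
  using \<alpha>_hom by (auto simp: hom_def)

lemma \<alpha>_mult: "e \<in> carrier E \<Longrightarrow> e' \<in> carrier E \<Longrightarrow> \<alpha> (e \<otimes>\<^bsub>E\<^esub> e') = \<alpha> e \<otimes>\<^bsub>B\<^esub> \<alpha> e'"
  using \<alpha>_hom by (auto simp: hom_def)

lemma \<alpha>_one: "\<alpha> \<one>\<^bsub>E\<^esub> = \<one>\<^bsub>B\<^esub>"
  using hom_one[OF \<alpha>_hom group_E group_B] .

sublocale B: group B by (rule group_B)

lemma restrict_action_simps [simp]:
  "carrier (restrict_action \<alpha> X) = carrier X"
  "monoid.mult (restrict_action \<alpha> X) = monoid.mult X"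
  "one (restrict_action \<alpha> X) = one X" "topo (restrict_action \<alpha> X) = topo X"
  "act (restrict_action \<alpha> X) e = act X (\<alpha> e)"
  by (simp_all add: restrict_action_def)

lemma hom_restrict_action [simp]:
  "hom (restrict_action \<alpha> X) Z = hom X Z" "hom Z (restrict_action \<alpha> X) = hom Z X"
  by (simp_all add: hom_def)

lemma pt_object_restrict_action:
  assumes X: "pt_object B X"
  shows "pt_object E (restrict_action \<alpha> X)"
proof -
  note XD = pt_objectD[OF X]
  let ?R = "restrict_action \<alpha> X"
  have inv: "inv\<^bsub>?R\<^esub> x = inv\<^bsub>X\<^esub> x" for x
    by (simp add: m_inv_def)
  have gR: "group ?R"
    using XD(2) group_cong[of ?R X] by simp
  then have "topological_group ?R"
    using XD(1) by (simp add: topological_group_def inv)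
  moreover have "act ?R \<in> hom E (AutoGroup ?R)"
  proof -
    have "act X b \<in> hom X X \<inter> extensional (carrier X)" if "b \<in> carrier B" for b
      using XD(4) that unfolding hom_AutoGroup_iff[OF group_B XD(2)] by blast
    then show ?thesis
      unfolding hom_AutoGroup_iff[OF group_E gR]
      using group_actD[OF group_B XD(2,4)] \<alpha>_closed \<alpha>_one \<alpha>_mult by simp
  qed
  moreover have "continuous_map (prod_topology (topo E) (topo X)) (topo X) (\<lambda>z. act X (\<alpha> (fst z)) (snd z))"
    by (intro continuous_map_action[OF X] continuous_map_snd
        continuous_map_compose[OF continuous_map_fst \<alpha>_continuous, unfolded o_def])
  ultimately show ?thesis
    by (simp add: pt_object_def case_prod_beta')
qed

lemma pt_hom_restrict_action: "pt_hom B X X' \<subseteq> pt_hom E (restrict_action \<alpha> X) (restrict_action \<alpha> X')"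
  using \<alpha>_closed by (auto simp: pt_hom_def)

section \<open>The group of equivariant maps\<close>

lemma hom_group_simps [simp]:
  "carrier (hom_group E B \<alpha> Y) = equivariant_maps E B \<alpha> Y"
  "monoid.mult (hom_group E B \<alpha> Y) = (\<lambda>u v. \<lambda>b\<in>carrier B. u b \<otimes>\<^bsub>Y\<^esub> v b)"
  "one (hom_group E B \<alpha> Y) = (\<lambda>b\<in>carrier B. \<one>\<^bsub>Y\<^esub>)"
  "act (hom_group E B \<alpha> Y) b = (\<lambda>u\<in>equivariant_maps E B \<alpha> Y. \<lambda>x\<in>carrier B. u (x \<otimes>\<^bsub>B\<^esub> b))"
  by (simp_all add: hom_group_def)

lemma equivariant_mapsD:
  assumes "u \<in> equivariant_maps E B \<alpha> Y"
  shows "b \<in> carrier B \<Longrightarrow> u b \<in> carrier Y" "u \<in> extensional (carrier B)"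
    "e \<in> carrier E \<Longrightarrow> b \<in> carrier B \<Longrightarrow> u (\<alpha> e \<otimes>\<^bsub>B\<^esub> b) = act Y e (u b)"
  using assms by (auto simp: equivariant_maps_def PiE_def)

lemma equivariant_mapsI:
  assumes "\<And>b. b \<in> carrier B \<Longrightarrow> u b \<in> carrier Y" "u \<in> extensional (carrier B)"
    "\<And>e b. e \<in> carrier E \<Longrightarrow> b \<in> carrier B \<Longrightarrow> u (\<alpha> e \<otimes>\<^bsub>B\<^esub> b) = act Y e (u b)"
  shows "u \<in> equivariant_maps E B \<alpha> Y"
  using assms by (auto simp: equivariant_maps_def PiE_def)

lemma translate_equivariant_map:
  assumes "u \<in> equivariant_maps E B \<alpha> Y" "b \<in> carrier B"
  shows "(\<lambda>x\<in>carrier B. u (x \<otimes>\<^bsub>B\<^esub> b)) \<in> equivariant_maps E B \<alpha> Y"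
  using assms equivariant_mapsD[OF assms(1)] \<alpha>_closed
  by (intro equivariant_mapsI) (auto simp: B.m_assoc)

text \<open>The equivariant maps form a subgroup of the power \<open>Y\<^sup>B\<close>, since \<open>E\<close> acts on \<open>Y\<close> by
  automorphisms.\<close>

lemma hom_group_group:
  assumes Y: "pt_object E Y"
  shows "group (hom_group E B \<alpha> Y)"
    and "u \<in> equivariant_maps E B \<alpha> Y \<Longrightarrow> inv\<^bsub>hom_group E B \<alpha> Y\<^esub> u = (\<lambda>b\<in>carrier B. inv\<^bsub>Y\<^esub> u b)"
proof -
  let ?M = "equivariant_maps E B \<alpha> Y" and ?P = "product_group (carrier B) (\<lambda>_. Y)"
  let ?H = "hom_group E B \<alpha> Y"
  note YD = pt_objectD[OF Y]
  note actD = group_actD[OF group_E YD(2,4)]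
  interpret Y: group Y by (rule YD(2))
  have P: "group ?P"
    by (rule product_group) (rule YD(2))
  have sub: "subgroup ?M ?P"
  proof (rule group.subgroupI[OF P])
    show "?M \<subseteq> carrier ?P"
      by (auto simp: equivariant_maps_def)
    have "(\<lambda>b\<in>carrier B. \<one>\<^bsub>Y\<^esub>) \<in> ?M"
      using actD \<alpha>_closed by (intro equivariant_mapsI) auto
    then show "?M \<noteq> {}"
      by blast
  next
    fix u assume u: "u \<in> ?M"
    have "inv\<^bsub>?P\<^esub> u = (\<lambda>b\<in>carrier B. inv\<^bsub>Y\<^esub> u b)"
      using u YD(2) by (intro inv_product_group) (auto simp: equivariant_maps_def)
    then show "inv\<^bsub>?P\<^esub> u \<in> ?M"
      using equivariant_mapsD[OF u] actD \<alpha>_closed by (auto intro!: equivariant_mapsI)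
  next
    fix u v assume u: "u \<in> ?M" and v: "v \<in> ?M"
    show "u \<otimes>\<^bsub>?P\<^esub> v \<in> ?M"
      using equivariant_mapsD[OF u] equivariant_mapsD[OF v] actD \<alpha>_closed
      by (auto intro!: equivariant_mapsI)
  qed
  have "group (?P\<lparr>carrier := ?M\<rparr>)"
    using P sub by (simp add: subgroup.subgroup_is_group)
  then show "group ?H"
    using group_cong[of ?H "?P\<lparr>carrier := ?M\<rparr>"] by simp
  show "inv\<^bsub>?H\<^esub> u = (\<lambda>b\<in>carrier B. inv\<^bsub>Y\<^esub> u b)" if u: "u \<in> ?M"
  proof -
    have "inv\<^bsub>?H\<^esub> u = inv\<^bsub>?P\<lparr>carrier := ?M\<rparr>\<^esub> u"
      by (simp add: m_inv_def)
    also have "\<dots> = inv\<^bsub>?P\<^esub> u"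
      by (rule group.m_inv_consistent[OF P sub u])
    also have "\<dots> = (\<lambda>b\<in>carrier B. inv\<^bsub>Y\<^esub> u b)"
      using u YD(2) by (intro inv_product_group) (auto simp: equivariant_maps_def)
    finally show ?thesis .
  qed
qed

lemma topspace_hom_group:
  assumes "pt_object E Y"
  shows "topspace (topo (hom_group E B \<alpha> Y)) = equivariant_maps E B \<alpha> Y"
  using pt_objectD(3)[OF assms] by (auto simp: hom_group_def equivariant_maps_def)

text \<open>The topology of pointwise convergence: continuity into \<open>hom\<^sub>E(B, Y)\<close> is tested at
  each \<open>b\<close> separately.\<close>

lemma continuous_map_hom_group_iff:
  "continuous_map A (topo (hom_group E B \<alpha> Y)) f \<longleftrightarrow>
    f \<in> topspace A \<rightarrow> equivariant_maps E B \<alpha> Y \<and>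
    (\<forall>b\<in>carrier B. continuous_map A (topo Y) (\<lambda>a. f a b))"
  using equivariant_mapsD(2)
  by (auto simp: hom_group_def continuous_map_in_subtopology continuous_map_componentwise image_subset_iff Pi_iff)

lemma continuous_map_eval_hom_group:
  assumes "continuous_map A (topo (hom_group E B \<alpha> Y)) f" "b \<in> carrier B"
  shows "continuous_map A (topo Y) (\<lambda>a. f a b)"
  using assms by (simp add: continuous_map_hom_group_iff)

lemma topological_group_hom_group:
  assumes Y: "pt_object E Y"
  shows "topological_group (hom_group E B \<alpha> Y)"
proof -
  let ?H = "hom_group E B \<alpha> Y"
  note gH = hom_group_group[OF Y] and ts = topspace_hom_group[OF Y]
  interpret H: group ?H by (rule gH)
  have "continuous_map (prod_topology (topo ?H) (topo ?H)) (topo ?H) (\<lambda>z. fst z \<otimes>\<^bsub>?H\<^esub> snd z)"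
    unfolding continuous_map_hom_group_iff
  proof (intro conjI ballI)
    show "(\<lambda>z. fst z \<otimes>\<^bsub>?H\<^esub> snd z) \<in> topspace (prod_topology (topo ?H) (topo ?H)) \<rightarrow> equivariant_maps E B \<alpha> Y"
      using H.m_closed ts by auto
    fix b assume b: "b \<in> carrier B"
    have "continuous_map (prod_topology (topo ?H) (topo ?H)) (topo Y) (\<lambda>z. fst z b \<otimes>\<^bsub>Y\<^esub> snd z b)"
      by (intro continuous_map_group_mult[OF pt_objectD(1)[OF Y]]
          continuous_map_eval_hom_group[OF _ b] continuous_map_fst continuous_map_snd)
    then show "continuous_map (prod_topology (topo ?H) (topo ?H)) (topo Y) (\<lambda>z. (fst z \<otimes>\<^bsub>?H\<^esub> snd z) b)"
      using b by simp
  qed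
  moreover have "continuous_map (topo ?H) (topo ?H) (\<lambda>u. inv\<^bsub>?H\<^esub> u)"
    unfolding continuous_map_hom_group_iff
  proof (intro conjI ballI)
    show "(\<lambda>u. inv\<^bsub>?H\<^esub> u) \<in> topspace (topo ?H) \<rightarrow> equivariant_maps E B \<alpha> Y"
      using H.inv_closed ts by auto
    fix b assume b: "b \<in> carrier B"
    have "continuous_map (topo ?H) (topo Y) (\<lambda>u. inv\<^bsub>Y\<^esub> u b)"
      by (intro continuous_map_group_inv[OF pt_objectD(1)[OF Y]]
          continuous_map_eval_hom_group[OF _ b]) (simp add: continuous_map_id[unfolded id_def])
    then show "continuous_map (topo ?H) (topo Y) (\<lambda>u. (inv\<^bsub>?H\<^esub> u) b)"
      by (rule continuous_map_eq) (use b gH(2) ts in simp)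
  qed
  ultimately show ?thesis
    using gH(1) ts by (simp add: topological_group_def case_prod_beta')
qed

text \<open>Translation is continuous because evaluating \<open>b \<cdot> u\<close> at \<open>x\<close> is evaluating \<open>u\<close>
  at \<open>x b\<close>. In general \<open>B\<close> does not act continuously here, as nothing controls \<open>u (x b)\<close>
  when \<open>b\<close> varies.\<close>

lemma hom_group_acts:
  assumes Y: "pt_object E Y"
  shows "acts_by_continuous_automorphisms B (hom_group E B \<alpha> Y)"
proof -
  let ?H = "hom_group E B \<alpha> Y" and ?M = "equivariant_maps E B \<alpha> Y"
  note gH = hom_group_group[OF Y] and ts = topspace_hom_group[OF Y]
  interpret H: group ?H by (rule gH)
  have mult: "(\<lambda>b\<in>carrier B. u b \<otimes>\<^bsub>Y\<^esub> v b) \<in> ?M" if "u \<in> ?M" "v \<in> ?M" for u v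
    using H.m_closed[of u v] that by simp
  have "act ?H \<in> hom B (AutoGroup ?H)"
    unfolding hom_AutoGroup_iff[OF group_B gH(1)]
  proof (intro conjI ballI)
    fix b assume b: "b \<in> carrier B"
    show "act ?H b \<in> hom ?H ?H \<inter> extensional (carrier ?H)"
      using b translate_equivariant_map mult
      by (auto simp: hom_def Pi_iff intro!: restrict_ext)
  next
    fix u assume u: "u \<in> carrier ?H"
    show "act ?H \<one>\<^bsub>B\<^esub> u = u"
      using u equivariant_mapsD[of u Y] by (auto intro!: extensionalityI[of _ "carrier B"])
  next
    fix b c u assume "b \<in> carrier B" "c \<in> carrier B" "u \<in> carrier ?H"
    then show "act ?H (b \<otimes>\<^bsub>B\<^esub> c) u = act ?H b (act ?H c u)"
      using translate_equivariant_map[of u Y c] by (auto simp: B.m_assoc intro!: restrict_ext)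
  qed
  moreover have "continuous_map (topo ?H) (topo ?H) (act ?H b)" if b: "b \<in> carrier B" for b
    unfolding continuous_map_hom_group_iff
  proof (intro conjI ballI)
    show "act ?H b \<in> topspace (topo ?H) \<rightarrow> ?M"
      using translate_equivariant_map b ts by auto
    fix x assume x: "x \<in> carrier B"
    have "continuous_map (topo ?H) (topo Y) (\<lambda>u. u (x \<otimes>\<^bsub>B\<^esub> b))"
      using x b by (intro continuous_map_eval_hom_group) (auto simp: continuous_map_id[unfolded id_def])
    then show "continuous_map (topo ?H) (topo Y) (\<lambda>u. act ?H b u x)"
      by (rule continuous_map_eq) (use x ts in simp)
  qed
  ultimately show ?thesis
    by (simp add: acts_by_continuous_automorphisms_def)
qed

section \<open>The adjunction\<close>

text \<open>The map \<open>b \<mapsto> f (b \<cdot> x)\<close> is \<open>E\<close>-equivariant because \<open>f\<close> is, and for fixed \<open>b\<close>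
  it depends continuously on \<open>x\<close>; pointwise continuity is all that the topology of
  \<open>hom\<^sub>E(B, Y)\<close> asks for.\<close>

lemma transpose_in_hom_group:
  assumes X: "pt_object B X" and Y: "pt_object E Y" and f: "f \<in> pt_hom E (restrict_action \<alpha> X) Y"
  shows "coinduction_transpose B X f \<in> pt_hom B X (hom_group E B \<alpha> Y)"
proof -
  note XD = pt_objectD[OF X]
  interpret X: group X by (rule XD(2))
  note actD = group_actD[OF group_B XD(2,4)]
  note fD = pt_homD[OF f, simplified]
  let ?k = "coinduction_transpose B X f"
  have M: "?k x \<in> equivariant_maps E B \<alpha> Y" if x: "x \<in> carrier X" for x
  proof (rule equivariant_mapsI)
    fix e b assume e: "e \<in> carrier E" and b: "b \<in> carrier B"
    have "f (act X (\<alpha> e \<otimes>\<^bsub>B\<^esub> b) x) = f (act X (\<alpha> e) (act X b x))"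
      using e b x \<alpha>_closed actD by simp
    then show "?k x (\<alpha> e \<otimes>\<^bsub>B\<^esub> b) = act Y e (?k x b)"
      using e b x \<alpha>_closed actD(1) fD(5) by (simp add: coinduction_transpose_def)
  qed (use x actD(1) fD(1) in \<open>auto simp: coinduction_transpose_def\<close>)
  moreover have "continuous_map (topo X) (topo Y) (\<lambda>x. ?k x b)" if b: "b \<in> carrier B" for b
  proof -
    have "continuous_map (topo X) (topo X) (\<lambda>x. act X b x)"
      using b pt_object_imp_acts[OF X topspace_B] acts_by_continuous_automorphismsD(2) by metis
    from continuous_map_compose[OF this fD(4)] show ?thesis
      by (rule continuous_map_eq) (use b XD in \<open>auto simp: coinduction_transpose_def\<close>)
  qed
  ultimately have "continuous_map (topo X) (topo (hom_group E B \<alpha> Y)) ?k"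
    using XD(3) by (auto simp: continuous_map_hom_group_iff)
  moreover have "?k (x \<otimes>\<^bsub>X\<^esub> y) = ?k x \<otimes>\<^bsub>hom_group E B \<alpha> Y\<^esub> ?k y" if "x \<in> carrier X" "y \<in> carrier X" for x y
    using that actD(1,2) fD(3) by (auto simp: coinduction_transpose_def intro!: restrict_ext)
  moreover have "?k (act X b x) = act (hom_group E B \<alpha> Y) b (?k x)" if "b \<in> carrier B" "x \<in> carrier X" for b x
    using that M[of x] actD by (auto simp: coinduction_transpose_def intro!: restrict_ext)
  ultimately show ?thesis
    using M by (auto simp: pt_hom_def hom_def coinduction_transpose_def)
qed

text \<open>The counit of the adjunction is evaluation at \<open>1\<close>. It is \<open>E\<close>-equivariant because
  \<open>(\<alpha> e \<cdot> u) 1 = u (1 \<cdot> \<alpha> e) = u (\<alpha> e \<cdot> 1)\<close>, where translation by \<open>\<alpha> e\<close> on the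
  right turns into one on the left.\<close>

lemma eval_one_pt_hom:
  assumes X: "pt_object B X" and Y: "pt_object E Y" and k: "k \<in> pt_hom B X (hom_group E B \<alpha> Y)"
  shows "(\<lambda>x\<in>carrier X. k x \<one>\<^bsub>B\<^esub>) \<in> pt_hom E (restrict_action \<alpha> X) Y" (is "?f \<in> _")
proof -
  note XD = pt_objectD[OF X]
  interpret X: group X by (rule XD(2))
  note actD = group_actD[OF group_B XD(2,4)]
  note kD = pt_homD[OF k]
  have M: "k x \<in> equivariant_maps E B \<alpha> Y" if "x \<in> carrier X" for x
    using kD(1)[OF that] by simp
  have "continuous_map (topo X) (topo Y) ?f"
    using continuous_map_eval_hom_group[OF kD(4) B.one_closed]
    by (rule continuous_map_eq) (simp add: XD)
  moreover have "?f (act X (\<alpha> e) x) = act Y e (?f x)" if e: "e \<in> carrier E" and x: "x \<in> carrier X" for e x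
  proof -
    have "k (act X (\<alpha> e) x) \<one>\<^bsub>B\<^esub> = k x (\<alpha> e)"
      using e x kD(5) M \<alpha>_closed by simp
    also have "\<dots> = k x (\<alpha> e \<otimes>\<^bsub>B\<^esub> \<one>\<^bsub>B\<^esub>)"
      using e \<alpha>_closed by simp
    also have "\<dots> = act Y e (k x \<one>\<^bsub>B\<^esub>)"
      using equivariant_mapsD(3)[OF M[OF x] e B.one_closed] .
    finally show ?thesis
      using e x \<alpha>_closed actD(1) by simp
  qed
  ultimately show ?thesis
    using kD(3) equivariant_mapsD(1)[OF M B.one_closed] by (auto simp: pt_hom_def hom_def)
qed

text \<open>A \<open>B\<close>-equivariant \<open>k\<close> is recovered from its values at \<open>1\<close>, since
  \<open>k x b = (b \<cdot> k x) 1 = k (b \<cdot> x) 1\<close>.\<close>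

lemma bij_betw_transpose_hom_group:
  assumes X: "pt_object B X" and Y: "pt_object E Y"
  shows "bij_betw (coinduction_transpose B X)
    (pt_hom E (restrict_action \<alpha> X) Y) (pt_hom B X (hom_group E B \<alpha> Y))"
proof (rule bij_betw_byWitness[where f' = "\<lambda>k. \<lambda>x\<in>carrier X. k x \<one>\<^bsub>B\<^esub>"])
  note XD = pt_objectD[OF X]
  note actD = group_actD[OF group_B XD(2,4)]
  show "\<forall>f\<in>pt_hom E (restrict_action \<alpha> X) Y.
      (\<lambda>x\<in>carrier X. coinduction_transpose B X f x \<one>\<^bsub>B\<^esub>) = f"
  proof
    fix f assume "f \<in> pt_hom E (restrict_action \<alpha> X) Y"
    then have "f \<in> extensional (carrier X)"
      by (simp add: pt_hom_def)
    then show "(\<lambda>x\<in>carrier X. coinduction_transpose B X f x \<one>\<^bsub>B\<^esub>) = f"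
      by (intro extensionalityI[of _ "carrier X"]) (auto simp: coinduction_transpose_def actD)
  qed
  show "\<forall>k\<in>pt_hom B X (hom_group E B \<alpha> Y).
      coinduction_transpose B X (\<lambda>x\<in>carrier X. k x \<one>\<^bsub>B\<^esub>) = k"
  proof
    fix k assume k: "k \<in> pt_hom B X (hom_group E B \<alpha> Y)"
    note kD = pt_homD[OF k]
    have "coinduction_transpose B X (\<lambda>x\<in>carrier X. k x \<one>\<^bsub>B\<^esub>) x = k x" if x: "x \<in> carrier X" for x
    proof (rule extensionalityI[of _ "carrier B"])
      have M: "k x \<in> equivariant_maps E B \<alpha> Y"
        using kD(1)[OF x] by simp
      then show "k x \<in> extensional (carrier B)"
        by (rule equivariant_mapsD)
      fix b assume b: "b \<in> carrier B"
      show "coinduction_transpose B X (\<lambda>x\<in>carrier X. k x \<one>\<^bsub>B\<^esub>) x b = k x b"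
        using b x M kD(5) actD(1) by (simp add: coinduction_transpose_def)
    qed (use x in \<open>simp add: coinduction_transpose_def\<close>)
    then show "coinduction_transpose B X (\<lambda>x\<in>carrier X. k x \<one>\<^bsub>B\<^esub>) = k"
      using kD(2) by (intro extensionalityI[of _ "carrier X"]) (auto simp: coinduction_transpose_def)
  qed
qed (use transpose_in_hom_group[OF X Y] eval_one_pt_hom[OF X Y] in blast)+

lemma pt_object_coinduction:
  assumes "pt_object E Y"
  shows "pt_object B (coinduction E B \<alpha> Y)"
  unfolding coinduction_def
  by (intro pt_object_t_infty B topological_group_hom_group hom_group_acts assms)

lemma pt_hom_coinduction_eq:
  assumes "pt_object B X" "pt_object E Y"
  shows "pt_hom B X (coinduction E B \<alpha> Y) = pt_hom B X (hom_group E B \<alpha> Y)"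
  unfolding coinduction_def
  by (intro pt_hom_t_infty_eq B topological_group_hom_group hom_group_acts assms)

lemma carrier_coinduction_subset:
  "carrier (coinduction E B \<alpha> Y) \<subseteq> carrier (hom_group E B \<alpha> Y)"
proof -
  have "carrier (coinduction E B \<alpha> Y) \<subseteq> carrier (t_iter B 0 (hom_group E B \<alpha> Y))"
    unfolding coinduction_def t_infty_simps by blast
  then show ?thesis by simp
qed

text \<open>The inclusion corresponds to the identity under \<open>pt_hom_coinduction_eq\<close>.\<close>

lemma coinduction_inclusion:
  assumes Y: "pt_object E Y"
  shows "(\<lambda>u\<in>carrier (coinduction E B \<alpha> Y). u) \<in> pt_hom B (coinduction E B \<alpha> Y) (hom_group E B \<alpha> Y)"
  using id_pt_hom[OF group_B pt_object_coinduction[OF Y]]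
    pt_hom_coinduction_eq[OF pt_object_coinduction[OF Y] Y] by simp

lemma postcompose_pt_hom:
  assumes Y: "pt_object E Y" and Y': "pt_object E Y'" and f: "f \<in> pt_hom E Y Y'"
  shows "(\<lambda>u\<in>equivariant_maps E B \<alpha> Y. compose (carrier B) f u)
    \<in> pt_hom B (hom_group E B \<alpha> Y) (hom_group E B \<alpha> Y')" (is "?F \<in> _")
proof -
  let ?H = "hom_group E B \<alpha> Y" and ?H' = "hom_group E B \<alpha> Y'"
  let ?M = "equivariant_maps E B \<alpha> Y" and ?M' = "equivariant_maps E B \<alpha> Y'"
  note fD = pt_homD[OF f] and ts = topspace_hom_group[OF Y]
  interpret H: group ?H by (rule hom_group_group[OF Y])
  have M: "compose (carrier B) f u \<in> ?M'" if "u \<in> ?M" for u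
    using equivariant_mapsD[OF that] fD(1,5) \<alpha>_closed
    by (intro equivariant_mapsI) (auto simp: compose_def)
  have mult: "(\<lambda>b\<in>carrier B. u b \<otimes>\<^bsub>Y\<^esub> v b) \<in> ?M" if "u \<in> ?M" "v \<in> ?M" for u v
    using H.m_closed[of u v] that by simp
  have "continuous_map (topo ?H) (topo ?H') ?F"
    unfolding continuous_map_hom_group_iff
  proof (intro conjI ballI)
    show "?F \<in> topspace (topo ?H) \<rightarrow> ?M'"
      using M ts by auto
    fix b assume b: "b \<in> carrier B"
    have "continuous_map (topo ?H) (topo Y) (\<lambda>u. u b)"
      using b by (intro continuous_map_eval_hom_group) (auto simp: continuous_map_id[unfolded id_def])
    from continuous_map_compose[OF this fD(4)] show "continuous_map (topo ?H) (topo Y') (\<lambda>u. ?F u b)"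
      by (rule continuous_map_eq) (use b ts in \<open>simp add: compose_def\<close>)
  qed
  moreover have "?F \<in> hom ?H ?H'"
    using M mult by (auto simp: hom_def compose_def fD(3) equivariant_mapsD(1) intro!: restrict_ext)
  moreover have "?F (act ?H b u) = act ?H' b (?F u)" if "b \<in> carrier B" "u \<in> ?M" for b u
    using that M translate_equivariant_map[of u Y b] by (auto simp: compose_def intro!: restrict_ext)
  ultimately show ?thesis
    by (simp add: pt_hom_def)
qed

text \<open>Post-composition is a morphism \<open>hom\<^sub>E(B, Y) \<rightarrow> hom\<^sub>E(B, Y')\<close>. Preceded by the
  inclusion it starts from a point over \<open>B\<close>, so it lands in the co-induced group of \<open>Y'\<close>.\<close>

lemma coinduction_map_pt_hom:
  assumes Y: "pt_object E Y" and Y': "pt_object E Y'" and f: "f \<in> pt_hom E Y Y'"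
  shows "coinduction_map E B \<alpha> Y f \<in> pt_hom B (coinduction E B \<alpha> Y) (coinduction E B \<alpha> Y')"
proof -
  have "coinduction_map E B \<alpha> Y f = compose (carrier (coinduction E B \<alpha> Y))
      (\<lambda>u\<in>equivariant_maps E B \<alpha> Y. compose (carrier B) f u)
      (\<lambda>u\<in>carrier (coinduction E B \<alpha> Y). u)"
    unfolding coinduction_map_def using carrier_coinduction_subset[of Y]
    by (auto simp: compose_def intro!: restrict_ext)
  then show ?thesis
    using compose_pt_hom[OF group_B pt_object_coinduction[OF Y] coinduction_inclusion[OF Y]
        postcompose_pt_hom[OF Y Y' f]]
    unfolding pt_hom_coinduction_eq[OF pt_object_coinduction[OF Y] Y'] by simp
qed

lemma coinduction_map_apply:
  assumes "u \<in> carrier (coinduction E B \<alpha> Y)"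
  shows "coinduction_map E B \<alpha> Y f u = (\<lambda>b\<in>carrier B. f (u b))"
  using assms by (simp add: coinduction_map_def compose_def)

lemma coinduction_map_id:
  "coinduction_map E B \<alpha> Y (\<lambda>y\<in>carrier Y. y) = (\<lambda>u\<in>carrier (coinduction E B \<alpha> Y). u)"
proof -
  have "compose (carrier B) (\<lambda>y\<in>carrier Y. y) u = u" if "u \<in> equivariant_maps E B \<alpha> Y" for u
    using equivariant_mapsD[OF that] by (intro extensionalityI[of _ "carrier B"]) (auto simp: compose_def)
  then show ?thesis
    unfolding coinduction_map_def using carrier_coinduction_subset[of Y] by (auto intro!: restrict_ext)
qed

lemma coinduction_map_compose:
  assumes Y: "pt_object E Y" and Y': "pt_object E Y'" and f: "f \<in> pt_hom E Y Y'"
  shows "coinduction_map E B \<alpha> Y (compose (carrier Y) g f) =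
    compose (carrier (coinduction E B \<alpha> Y)) (coinduction_map E B \<alpha> Y' g) (coinduction_map E B \<alpha> Y f)"
proof -
  have "(\<lambda>b\<in>carrier B. compose (carrier Y) g f (u b)) =
      coinduction_map E B \<alpha> Y' g (coinduction_map E B \<alpha> Y f u)"
    if u: "u \<in> carrier (coinduction E B \<alpha> Y)" for u
  proof -
    have "u \<in> equivariant_maps E B \<alpha> Y"
      using u carrier_coinduction_subset[of Y] by auto
    then show ?thesis
      using pt_homD(1)[OF coinduction_map_pt_hom[OF Y Y' f] u]
      by (auto simp: coinduction_map_apply u compose_def equivariant_mapsD(1) intro!: restrict_ext)
  qed
  then show ?thesis
    unfolding compose_def[of "carrier (coinduction E B \<alpha> Y)"]
    by (subst coinduction_map_def) (auto simp: compose_def intro!: restrict_ext)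
qed

lemma bij_betw_coinduction_transpose:
  assumes "pt_object B X" "pt_object E Y"
  shows "bij_betw (coinduction_transpose B X)
    (pt_hom E (restrict_action \<alpha> X) Y) (pt_hom B X (coinduction E B \<alpha> Y))"
  using bij_betw_transpose_hom_group[OF assms] pt_hom_coinduction_eq[OF assms] by simp

lemma coinduction_transpose_precompose:
  assumes X': "pt_object B X'" and h: "h \<in> pt_hom B X' X"
  shows "coinduction_transpose B X' (compose (carrier X') f h) =
    compose (carrier X') (coinduction_transpose B X f) h"
  using pt_homD(1,5)[OF h] group_actD(1)[OF group_B pt_objectD(2,4)[OF X']]
  by (auto simp: coinduction_transpose_def compose_def intro!: restrict_ext)

lemma coinduction_transpose_postcompose:
  assumes X: "pt_object B X" and Y: "pt_object E Y" and f: "f \<in> pt_hom E (restrict_action \<alpha> X) Y"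
  shows "coinduction_transpose B X (compose (carrier X) g f) =
    compose (carrier X) (coinduction_map E B \<alpha> Y g) (coinduction_transpose B X f)"
proof -
  have "coinduction_transpose B X f \<in> pt_hom B X (coinduction E B \<alpha> Y)"
    using bij_betw_coinduction_transpose[OF X Y] f by (auto simp: bij_betw_def)
  note tD = pt_homD(1)[OF this]
  have "coinduction_transpose B X (compose (carrier X) g f) x =
      coinduction_map E B \<alpha> Y g (coinduction_transpose B X f x)" if x: "x \<in> carrier X" for x
    using x group_actD(1)[OF group_B pt_objectD(2,4)[OF X]]
    by (subst coinduction_map_apply[OF tD[OF x]])
      (auto simp: coinduction_transpose_def compose_def intro!: restrict_ext)
  then show ?thesis
    by (intro extensionalityI[of _ "carrier X"]) (auto simp: coinduction_transpose_def compose_def)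
qed

text \<open>The factorisation of \<open>j\<close> is \<open>j\<close> itself, with a smaller codomain.\<close>

lemma coinduction_largest:
  assumes X: "pt_object B X" and Y: "pt_object E Y" and j: "j \<in> pt_hom B X (hom_group E B \<alpha> Y)"
  shows "\<exists>k\<in>pt_hom B X (coinduction E B \<alpha> Y).
    j = compose (carrier X) (\<lambda>u\<in>carrier (coinduction E B \<alpha> Y). u) k"
proof
  show k: "j \<in> pt_hom B X (coinduction E B \<alpha> Y)"
    using j pt_hom_coinduction_eq[OF X Y] by simp
  show "j = compose (carrier X) (\<lambda>u\<in>carrier (coinduction E B \<alpha> Y). u) j"
    using pt_homD(1,2)[OF k] by (intro extensionalityI[of _ "carrier X"]) (auto simp: compose_def)
qed

end

theorem theorem3p1:
  fixes E :: "'e topgroup" and B :: "'b topgroup" and \<alpha> :: "'e \<Rightarrow> 'b"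
  assumes "topological_group E" and "locally_compact_space (topo E)"
    and "topological_group B" and "locally_compact_space (topo B)"
    and "\<alpha> \<in> hom E B" and "continuous_map (topo E) (topo B) \<alpha>"
  shows
    \<comment> \<open>restriction along \<open>\<alpha>\<close> is a functor\<close>
    "(\<forall>X :: ('b, 'x) actgroup. pt_object B X \<longrightarrow> pt_object E (restrict_action \<alpha> X)) \<and>
     (\<forall>(X :: ('b, 'x) actgroup) (X' :: ('b, 'x1) actgroup). pt_object B X \<and> pt_object B X' \<longrightarrow>
        pt_hom B X X' \<subseteq> pt_hom E (restrict_action \<alpha> X) (restrict_action \<alpha> X')) \<and>
     \<comment> \<open>co-induction along \<open>\<alpha>\<close> is a functor\<close>
     (\<forall>Y :: ('e, 'y) actgroup. pt_object E Y \<longrightarrow> pt_object B (coinduction E B \<alpha> Y)) \<and>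
     (\<forall>(Y :: ('e, 'y) actgroup) (Y' :: ('e, 'y1) actgroup). \<forall>f \<in> pt_hom E Y Y'.
        pt_object E Y \<and> pt_object E Y' \<longrightarrow>
        coinduction_map E B \<alpha> Y f \<in> pt_hom B (coinduction E B \<alpha> Y) (coinduction E B \<alpha> Y')) \<and>
     (\<forall>Y :: ('e, 'y) actgroup. pt_object E Y \<longrightarrow>
        coinduction_map E B \<alpha> Y (\<lambda>y\<in>carrier Y. y) = (\<lambda>u\<in>carrier (coinduction E B \<alpha> Y). u)) \<and>
     (\<forall>(Y :: ('e, 'y) actgroup) (Y' :: ('e, 'y1) actgroup) (Y'' :: ('e, 'y2) actgroup).
        \<forall>f \<in> pt_hom E Y Y'. \<forall>g \<in> pt_hom E Y' Y''.
        pt_object E Y \<and> pt_object E Y' \<and> pt_object E Y'' \<longrightarrow>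
        coinduction_map E B \<alpha> Y (compose (carrier Y) g f) =
          compose (carrier (coinduction E B \<alpha> Y))
            (coinduction_map E B \<alpha> Y' g) (coinduction_map E B \<alpha> Y f)) \<and>
     \<comment> \<open>it is right adjoint to restriction: bijection of hom-sets, natural in both variables\<close>
     (\<forall>(X :: ('b, 'x) actgroup) (Y :: ('e, 'y) actgroup). pt_object B X \<and> pt_object E Y \<longrightarrow>
        bij_betw (coinduction_transpose B X)
          (pt_hom E (restrict_action \<alpha> X) Y) (pt_hom B X (coinduction E B \<alpha> Y))) \<and>
     (\<forall>(X :: ('b, 'x) actgroup) (X' :: ('b, 'x1) actgroup) (Y :: ('e, 'y) actgroup).
        \<forall>h \<in> pt_hom B X' X. \<forall>f \<in> pt_hom E (restrict_action \<alpha> X) Y.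
        pt_object B X \<and> pt_object B X' \<and> pt_object E Y \<longrightarrow>
        coinduction_transpose B X' (compose (carrier X') f h) =
          compose (carrier X') (coinduction_transpose B X f) h) \<and>
     (\<forall>(X :: ('b, 'x) actgroup) (Y :: ('e, 'y) actgroup) (Y' :: ('e, 'y1) actgroup).
        \<forall>f \<in> pt_hom E (restrict_action \<alpha> X) Y. \<forall>g \<in> pt_hom E Y Y'.
        pt_object B X \<and> pt_object E Y \<and> pt_object E Y' \<longrightarrow>
        coinduction_transpose B X (compose (carrier X) g f) =
          compose (carrier X) (coinduction_map E B \<alpha> Y g) (coinduction_transpose B X f)) \<and>
     \<comment> \<open>\<open>t\<^sup>\<infinity>\<close> is the largest topological group with a monomorphism into \<open>hom_group\<close> on which
        \<open>B\<close> acts continuously\<close>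
     (\<forall>Y :: ('e, 'y) actgroup. pt_object E Y \<longrightarrow>
        topological_group (hom_group E B \<alpha> Y) \<and>
        acts_by_continuous_automorphisms B (hom_group E B \<alpha> Y) \<and>
        pt_object B (t_infty B (hom_group E B \<alpha> Y)) \<and>
        carrier (t_infty B (hom_group E B \<alpha> Y)) \<subseteq> carrier (hom_group E B \<alpha> Y) \<and>
        (\<lambda>u\<in>carrier (t_infty B (hom_group E B \<alpha> Y)). u)
          \<in> pt_hom B (t_infty B (hom_group E B \<alpha> Y)) (hom_group E B \<alpha> Y) \<and>
        (\<forall>X :: ('b, 'x) actgroup. \<forall>j \<in> pt_hom B X (hom_group E B \<alpha> Y).
           pt_object B X \<and> inj_on j (carrier X) \<longrightarrow>
           (\<exists>k \<in> pt_hom B X (t_infty B (hom_group E B \<alpha> Y)).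
              j = compose (carrier X)
                    (\<lambda>u\<in>carrier (t_infty B (hom_group E B \<alpha> Y)). u) k)))"
proof -
  interpret coinduction_along E B \<alpha>
    using assms by (intro coinduction_along.intro)
  \<comment> \<open>the claims about \<open>t\<^sup>\<infinity>\<close> of the group of equivariant maps are claims about the co-induced group\<close>
  show ?thesis
    unfolding coinduction_def[symmetric]
    by (intro conjI allI impI ballI pt_object_restrict_action pt_hom_restrict_action
        pt_object_coinduction coinduction_map_pt_hom coinduction_map_id coinduction_map_compose
        bij_betw_coinduction_transpose coinduction_transpose_precompose
        coinduction_transpose_postcompose topological_group_hom_group hom_group_acts
        carrier_coinduction_subset coinduction_inclusion coinduction_largest;
      (elim conjE)?; assumption)
qed

end
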